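(* Let $G$ and $H$ be graphs. Then $G$ and $H$ are isomorphic if and only if $G\cong_{\mathcal{CP}}H$. Furthermore, $G$ and $H$ are quantum isomorphic if and only if $G\cong_{\mathcal{CS}_+}H$.
   Context: Graphs are finite, simple and undirected, with vertex sets $V_G$, $V_H$ assumed disjoint. For vertices $x,y$ of the same graph, $\mathrm{rel}(x,y)$ denotes their relationship: equal, adjacent, or distinct non-adjacent. Cones: $\mathcal{CP}$ (completely positive matrices) is the set of Gram matrices of entrywise nonnegative real vectors. $\mathcal{CS}_+$ (completely positive semidefinite matrices) is the set of matrices $M$ for which there exist $d$ and Hermitian positive semidefinite $d\times d$ matrices $\rho_1,\dots,\rho_n$ with $M_{ij}=\mathrm{Tr}(\rho_i^\dagger\rho_j)$. For a convex cone of matrices $\mathcal K$, write $G\cong_{\mathcal K}H$ if there is a matrix $M\in\mathcal K$ with rows and columns indexed by $V_G\times V_H$ such that: $\sum_{h,h'\in V_H}M_{gh,g'h'}=1$ for all $g,g'\in V_G$; $\sum_{g,g'\in V_G}M_{gh,g'h'}=1$ for all $h,h'\in V_H$; and $M_{gh,g'h'}=0$ whenever $\mathrm{rel}(g,g')\neq\mathrm{rel}(h,h')$. The $(G,H)$-isomorphism game: put $V=V_G\cup V_H$. Alice and Bob receive $x_A,x_B\in V$ and respond, without communicating, with $y_A,y_B\in V$. They win if (i) $x_A\in V_G\Leftrightarrow y_A\in V_H$ and $x_B\in V_G\Leftrightarrow y_B\in V_H$, and (ii) $\mathrm{rel}(g_A,g_B)=\mathrm{rel}(h_A,h_B)$,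 where $g_A$ (resp. $h_A$) is the unique vertex of $G$ (resp. $H$) among $x_A,y_A$, and $g_B,h_B$ are defined similarly from $x_B,y_B$. A quantum strategy consists of a unit vector $\psi\in\mathbb C^d\otimes\mathbb C^d$ for some finite $d$ (of full Schmidt rank, without loss of generality) and, for each $x\in V$, POVMs $(P_{xy})_{y\in V}$ for Alice and $(Q_{xy})_{y\in V}$ for Bob (families of positive semidefinite $d\times d$ matrices summing to the identity); it yields $p(y,y'|x,x')=\psi^\dagger(P_{xy}\otimes Q_{x'y'})\psi$. It is perfect (winning) if $p(y_A,y_B|x_A,x_B)=0$ whenever the winning conditions (i), (ii) fail. $G$ and $H$ are quantum isomorphic if there is a perfect quantum strategy for the $(G,H)$-isomorphism game. *)

theory Defs
  imports
    "Jordan_Normal_Form.Schur_Decomposition"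
    "Graph_Theory.Graph_Theory"
begin

text \<open>
  A finite simple undirected graph is a \<open>pair_graph\<close>: finite, loop-free, and with a symmetric set of
  arcs, so that an edge \<open>{u, v}\<close> is the pair of arcs \<open>(u, v)\<close>, \<open>(v, u)\<close>.
\<close>

section \<open>Relationship of vertices and isomorphism relative to a cone\<close>

datatype relationship = Equal | Adjacent | Nonadjacent

definition rel :: "'a pair_pre_digraph \<Rightarrow> 'a \<Rightarrow> 'a \<Rightarrow> relationship" where
  "rel G x y = (if x = y then Equal else if (x, y) \<in> parcs G then Adjacent else Nonadjacent)"

text \<open>
  A real matrix with rows and columns indexed by a finite set \<open>I\<close> is a function
  \<open>'i \<Rightarrow> 'i \<Rightarrow> real\<close> of which only the values on \<open>I \<times> I\<close> matter. A cone of matrices is given for every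
  index set \<open>I\<close>.
\<close>

definition CP :: "'i set \<Rightarrow> ('i \<Rightarrow> 'i \<Rightarrow> real) set" where
  "CP I = {M. \<exists>(d :: nat) (v :: 'i \<Rightarrow> real vec).
      (\<forall>i\<in>I. v i \<in> carrier_vec d \<and> (\<forall>k<d. 0 \<le> v i $ k)) \<and>
      (\<forall>i\<in>I. \<forall>j\<in>I. M i j = v i \<bullet> v j)}"

definition psd :: "nat \<Rightarrow> complex mat \<Rightarrow> bool" where
  "psd d A \<longleftrightarrow> A \<in> carrier_mat d d \<and> mat_adjoint A = A \<and>
     (\<forall>v \<in> carrier_vec d. 0 \<le> Re ((A *\<^sub>v v) \<bullet>c v))"

definition mat_trace :: "complex mat \<Rightarrow> complex" where
  "mat_trace A = (\<Sum>i<dim_row A. A $$ (i, i))"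

definition CSP :: "'i set \<Rightarrow> ('i \<Rightarrow> 'i \<Rightarrow> real) set" where
  "CSP I = {M. \<exists>(d :: nat) (\<rho> :: 'i \<Rightarrow> complex mat).
      (\<forall>i\<in>I. psd d (\<rho> i)) \<and>
      (\<forall>i\<in>I. \<forall>j\<in>I. complex_of_real (M i j) = mat_trace (mat_adjoint (\<rho> i) * \<rho> j))}"

definition cone_isomorphic ::
  "(('a \<times> 'b) set \<Rightarrow> ('a \<times> 'b \<Rightarrow> 'a \<times> 'b \<Rightarrow> real) set) \<Rightarrow>
    'a pair_pre_digraph \<Rightarrow> 'b pair_pre_digraph \<Rightarrow> bool" where
  "cone_isomorphic K G H \<longleftrightarrow> (\<exists>M \<in> K (pverts G \<times> pverts H).
     (\<forall>g\<in>pverts G. \<forall>g'\<in>pverts G. (\<Sum>h\<in>pverts H. \<Sum>h'\<in>pverts H. M (g, h) (g', h')) = 1) \<and>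
     (\<forall>h\<in>pverts H. \<forall>h'\<in>pverts H. (\<Sum>g\<in>pverts G. \<Sum>g'\<in>pverts G. M (g, h) (g', h')) = 1) \<and>
     (\<forall>g\<in>pverts G. \<forall>g'\<in>pverts G. \<forall>h\<in>pverts H. \<forall>h'\<in>pverts H.
        rel G g g' \<noteq> rel H h h' \<longrightarrow> M (g, h) (g', h') = 0))"

section \<open>Quantum strategies\<close>

definition kronecker :: "complex mat \<Rightarrow> complex mat \<Rightarrow> complex mat" where
  "kronecker A B = mat (dim_row A * dim_row B) (dim_col A * dim_col B)
     (\<lambda>(i, j). A $$ (i div dim_row B, j div dim_col B) * B $$ (i mod dim_row B, j mod dim_col B))"

definition povm :: "nat \<Rightarrow> 'y set \<Rightarrow> ('y \<Rightarrow> complex mat) \<Rightarrow> bool" where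
  "povm d Y P \<longleftrightarrow> (\<forall>y\<in>Y. psd d (P y)) \<and> mat d d (\<lambda>ij. \<Sum>y\<in>Y. P y $$ ij) = 1\<^sub>m d"

text \<open>
  \<open>\<complex>\<^sup>d \<otimes> \<complex>\<^sup>d\<close> is the space of complex vectors of dimension \<open>d * d\<close>, in accordance with
  \<open>kronecker\<close>. The state is not required to have full Schmidt rank.
\<close>

definition quantum_strategy ::
  "'v set \<Rightarrow> nat \<Rightarrow> complex vec \<Rightarrow> ('v \<Rightarrow> 'v \<Rightarrow> complex mat) \<Rightarrow> ('v \<Rightarrow> 'v \<Rightarrow> complex mat) \<Rightarrow> bool" where
  "quantum_strategy V d \<psi> P Q \<longleftrightarrow>
     \<psi> \<in> carrier_vec (d * d) \<and> \<psi> \<bullet>c \<psi> = 1 \<and>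
     (\<forall>x\<in>V. povm d V (P x)) \<and> (\<forall>x\<in>V. povm d V (Q x))"

definition correlation ::
  "complex vec \<Rightarrow> ('v \<Rightarrow> 'v \<Rightarrow> complex mat) \<Rightarrow> ('v \<Rightarrow> 'v \<Rightarrow> complex mat) \<Rightarrow>
    'v \<Rightarrow> 'v \<Rightarrow> 'v \<Rightarrow> 'v \<Rightarrow> complex" where
  "correlation \<psi> P Q y y' x x' = (kronecker (P x y) (Q x' y') *\<^sub>v \<psi>) \<bullet>c \<psi>"

section \<open>The isomorphism game\<close>

text \<open>
  The disjoint union of the vertex sets is \<open>pverts G <+> pverts H\<close>; a vertex of it belongs to \<open>G\<close> iff
  it satisfies \<open>isl\<close>. If exactly one of \<open>x\<close>, \<open>y\<close> belongs to \<open>G\<close>, then \<open>G_vertex x y\<close> is that vertex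
  and \<open>H_vertex x y\<close> is the other one; otherwise their values are not used.
\<close>

definition G_vertex :: "'a + 'b \<Rightarrow> 'a + 'b \<Rightarrow> 'a" where
  "G_vertex x y = (if isl x then projl x else projl y)"

definition H_vertex :: "'a + 'b \<Rightarrow> 'a + 'b \<Rightarrow> 'b" where
  "H_vertex x y = (if isl x then projr y else projr x)"

definition wins_iso_game ::
  "'a pair_pre_digraph \<Rightarrow> 'b pair_pre_digraph \<Rightarrow>
    'a + 'b \<Rightarrow> 'a + 'b \<Rightarrow> 'a + 'b \<Rightarrow> 'a + 'b \<Rightarrow> bool" where
  "wins_iso_game G H xA xB yA yB \<longleftrightarrow>
     (isl xA \<longleftrightarrow> \<not> isl yA) \<and> (isl xB \<longleftrightarrow> \<not> isl yB) \<and>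
     rel G (G_vertex xA yA) (G_vertex xB yB) = rel H (H_vertex xA yA) (H_vertex xB yB)"

definition quantum_isomorphic :: "'a pair_pre_digraph \<Rightarrow> 'b pair_pre_digraph \<Rightarrow> bool" where
  "quantum_isomorphic G H \<longleftrightarrow> (let V = pverts G <+> pverts H in
     \<exists>d \<psi> P Q. quantum_strategy V d \<psi> P Q \<and>
       (\<forall>xA\<in>V. \<forall>xB\<in>V. \<forall>yA\<in>V. \<forall>yB\<in>V.
          \<not> wins_iso_game G H xA xB yA yB \<longrightarrow> correlation \<psi> P Q yA yB xA xB = 0))"

end

theory Submission
  imports Defs
begin

text \<open>
  Both cone characterisations rest on one fact: if vectors \<open>s g\<close> have all inner products equal to 1,
  they are all equal. For a Gram matrix with row sums and column sums 1 this makes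
  \<open>s = \<Sum>h. v (g, h)\<close> independent of \<open>g\<close> and \<open>t = \<Sum>g. v (g, h)\<close> independent of \<open>h\<close>, while vectors in
  one row or one column are orthogonal. For entrywise nonnegative vectors, a coordinate where \<open>s\<close> is
  positive lies in the support of exactly one vector per row and per column: this is the isomorphism.
  For positive semidefinite matrices the support projections of the \<open>\<rho> (g, h)\<close> are measurements, and
  \<open>s\<close>, read as a vector of \<open>\<complex>\<^sup>d \<otimes> \<complex>\<^sup>d\<close>, is the state.

  Conversely, read the state of a perfect strategy as a matrix \<open>S\<close>, so that the correlations are
  \<open>Tr (S\<^sup>* P S B)\<close> with \<open>B\<close> the transposes of Bob's operators. Perfection forces \<open>P S = S B\<close>, so \<open>B\<close>
  commutes with \<open>S\<^sup>* S\<close> and with its square root \<open>R\<close>, and the matrices \<open>R B = B R B\<close> are the required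
  \<open>\<rho>\<close>. Since \<open>S\<close> may be singular, all identities are kept multiplied by \<open>S\<close> or \<open>R\<close>.
\<close>

section \<open>Graph isomorphisms and completely positive matrices\<close>

lemma pair_graphD:
  assumes "pair_graph G"
  shows "finite (pverts G)" and "parcs G \<subseteq> pverts G \<times> pverts G" and "(x, x) \<notin> parcs G"
proof -
  interpret pair_graph G by fact
  show "finite (pverts G)" by (rule pair_finite_verts)
  show "parcs G \<subseteq> pverts G \<times> pverts G" by (auto dest: in_arcsD1 in_arcsD2)
  show "(x, x) \<notin> parcs G" using pair_no_loops[of "(x, x)"] by auto
qed

lemma rel_eq_Equal_iff [simp]:
  "rel G x y = Equal \<longleftrightarrow> x = y" "Equal = rel G x y \<longleftrightarrow> x = y"
  by (auto simp: rel_def)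

lemma rel_refl [simp]: "rel G x x = Equal"
  by (simp add: rel_def)

lemma rel_eq_Adjacent_iff:
  assumes "pair_graph G"
  shows "rel G x y = Adjacent \<longleftrightarrow> (x, y) \<in> parcs G"
  using pair_graphD(3)[OF assms] by (auto simp: rel_def)

text \<open>In \<open>with_proj\<close> an arc is the pair of its ends, so the vertex map of an
  isomorphism determines its arc map. Preserving and reflecting arcs then amounts to preserving
  \<open>rel\<close>, since an injective vertex map already respects equality.\<close>

lemma digraph_iso_with_proj_iff:
  assumes G: "pair_graph G" and H: "pair_graph H"
  shows "digraph_iso (with_proj G) (with_proj H) \<longleftrightarrow>
    (\<exists>f. bij_betw f (pverts G) (pverts H) \<and>
       (\<forall>g\<in>pverts G. \<forall>g'\<in>pverts G. rel G g g' = rel H (f g) (f g')))"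
    (is "?L \<longleftrightarrow> ?R")
proof
  assume ?L
  then obtain i where i: "pre_digraph.digraph_isomorphism (with_proj G) i"
    and HG: "with_proj H = app_iso i (with_proj G)"
    unfolding digraph_iso_def by blast
  let ?f = "iso_verts i"
  have V: "pverts H = ?f ` pverts G" and A: "parcs H = iso_arcs i ` parcs G"
    and tl: "iso_tail i = fst" and hd: "iso_head i = snd"
    using HG by (auto simp: app_iso_def with_proj_def)
  have inj: "inj_on ?f (pverts G)"
    and ends: "\<And>a. a \<in> parcs G \<Longrightarrow> iso_arcs i a = (?f (fst a), ?f (snd a))"
    using i tl hd by (auto simp: pre_digraph.digraph_isomorphism_def prod_eq_iff)
  have "(g, g') \<in> parcs G \<longleftrightarrow> (?f g, ?f g') \<in> parcs H"
    if "g \<in> pverts G" "g' \<in> pverts G" for g g'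
  proof
    assume "(g, g') \<in> parcs G"
    then show "(?f g, ?f g') \<in> parcs H" using ends A by force
  next
    assume "(?f g, ?f g') \<in> parcs H"
    then obtain a where a: "a \<in> parcs G" "(?f g, ?f g') = iso_arcs i a" using A by auto
    then have "fst a \<in> pverts G" "snd a \<in> pverts G" using pair_graphD(2)[OF G] by auto
    then have "a = (g, g')" using a ends inj that by (auto simp: inj_on_eq_iff prod_eq_iff)
    then show "(g, g') \<in> parcs G" using a by simp
  qed
  then have "\<forall>g\<in>pverts G. \<forall>g'\<in>pverts G. rel G g g' = rel H (?f g) (?f g')"
    using inj by (auto simp: rel_def inj_on_eq_iff)
  moreover have "bij_betw ?f (pverts G) (pverts H)" using inj V by (simp add: bij_betw_def)
  ultimately show ?R by blast
next
  assume ?R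
  then obtain f where bij: "bij_betw f (pverts G) (pverts H)"
    and rel: "\<And>g g'. g \<in> pverts G \<Longrightarrow> g' \<in> pverts G \<Longrightarrow> rel G g g' = rel H (f g) (f g')"
    by blast
  have inj: "inj_on f (pverts G)" and V: "pverts H = f ` pverts G"
    using bij by (auto simp: bij_betw_def)
  have arc: "(g, g') \<in> parcs G \<longleftrightarrow> (f g, f g') \<in> parcs H"
    if "g \<in> pverts G" "g' \<in> pverts G" for g g'
    using rel[OF that] by (metis rel_eq_Adjacent_iff[OF G] rel_eq_Adjacent_iff[OF H])
  have A: "parcs H = map_prod f f ` parcs G"
  proof (intro equalityI subsetI)
    fix b assume b: "b \<in> parcs H"
    then obtain g g' where "g \<in> pverts G" "g' \<in> pverts G" "b = (f g, f g')"
      using pair_graphD(2)[OF H] V by auto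
    then show "b \<in> map_prod f f ` parcs G" using arc b by force
  next
    fix b assume "b \<in> map_prod f f ` parcs G"
    then show "b \<in> parcs H" using arc pair_graphD(2)[OF G] by auto
  qed
  let ?i = "\<lparr>iso_verts = f, iso_arcs = map_prod f f, iso_head = snd, iso_tail = fst\<rparr>"
  interpret pair_graph G by fact
  have "inj_on (map_prod f f) (pverts G \<times> pverts G)" using inj by (auto simp: inj_on_def)
  then have "inj_on (map_prod f f) (parcs G)"
    using pair_graphD(2)[OF G] inj_on_subset by blast
  then have "pre_digraph.digraph_isomorphism (with_proj G) ?i"
    using inj wf_digraph_axioms by (auto simp: pre_digraph.digraph_isomorphism_def)
  moreover have "with_proj H = app_iso ?i (with_proj G)"
    using V A by (simp add: app_iso_def with_proj_def)
  ultimately show ?L unfolding digraph_iso_def by blast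
qed

text \<open>The entries of the permutation matrix of \<open>f\<close>, read as vectors of dimension
  1, have a Gram matrix whose row and column sums factor into products of sums equal to 1.\<close>

lemma CP_isomorphic_if_bij:
  assumes fin: "finite (pverts G)" "finite (pverts H)"
    and bij: "bij_betw f (pverts G) (pverts H)"
    and rel: "\<And>g g'. g \<in> pverts G \<Longrightarrow> g' \<in> pverts G \<Longrightarrow> rel G g g' = rel H (f g) (f g')"
  shows "cone_isomorphic CP G H"
proof -
  define v where "v = (\<lambda>(g, h). if h = f g then 1 else 0 :: real)"
  let ?M = "\<lambda>i j. v i * v j"
  have sums: "(\<Sum>h\<in>pverts H. v (g, h)) = 1" if "g \<in> pverts G" for g
    using bij_betw_apply[OF bij that] fin by (simp add: v_def)
  have sumt: "(\<Sum>g\<in>pverts G. v (g, h)) = 1" if "h \<in> pverts H" for h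
  proof -
    from that have "h \<in> f ` pverts G" by (simp add: bij_betw_imp_surj_on[OF bij])
    then obtain g where g: "g \<in> pverts G" "h = f g" by blast
    have "(\<Sum>g'\<in>pverts G. v (g', h)) = (\<Sum>g'\<in>pverts G. if g' = g then 1 else 0)"
      using g bij by (intro sum.cong) (auto simp: v_def dest: bij_betw_imp_inj_on inj_onD)
    then show ?thesis using g fin by simp
  qed
  have v_zero: "v (g, h) * v (g', h') = 0"
    if "g \<in> pverts G" "g' \<in> pverts G" "rel G g g' \<noteq> rel H h h'" for g g' h h'
    using that rel by (auto simp: v_def)
  have v_nonneg: "0 \<le> v i" for i by (cases i) (simp add: v_def)
  have M: "?M \<in> CP (pverts G \<times> pverts H)"
    unfolding CP_def mem_Collect_eq
    by (rule exI[of _ 1], rule exI[of _ "\<lambda>i. vec 1 (\<lambda>_. v i)"])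
      (simp add: scalar_prod_def v_nonneg)
  have row: "(\<Sum>h\<in>pverts H. \<Sum>h'\<in>pverts H. v (g, h) * v (g', h')) = 1"
    if "g \<in> pverts G" "g' \<in> pverts G" for g g'
    using sum_product[of "\<lambda>h. v (g, h)" "pverts H" "\<lambda>h'. v (g', h')" "pverts H"]
      sums[OF that(1)] sums[OF that(2)] by simp
  have col: "(\<Sum>g\<in>pverts G. \<Sum>g'\<in>pverts G. v (g, h) * v (g', h')) = 1"
    if "h \<in> pverts H" "h' \<in> pverts H" for h h'
    using sum_product[of "\<lambda>g. v (g, h)" "pverts G" "\<lambda>g'. v (g', h')" "pverts G"]
      sumt[OF that(1)] sumt[OF that(2)] by simp
  show ?thesis
    unfolding cone_isomorphic_def
    by (rule bexI[OF _ M], intro conjI ballI impI)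
      (rule row col v_zero, assumption+)+
qed

text \<open>The squared distance of \<open>x\<close> and \<open>y\<close> expands to
  \<open>1 + 1 - 2 * 1\<close>.\<close>

lemma eq_if_unit_products:
  fixes x y :: "nat \<Rightarrow> real"
  assumes "(\<Sum>k<d. x k * x k) = 1" "(\<Sum>k<d. y k * y k) = 1" "(\<Sum>k<d. x k * y k) = 1" and "k < d"
  shows "x k = y k"
proof -
  have "(\<Sum>k<d. (x k - y k)\<^sup>2) = (\<Sum>k<d. x k * x k + y k * y k - 2 * (x k * y k))"
    by (intro sum.cong) (auto simp: power2_eq_square algebra_simps)
  also have "\<dots> = 0" using assms(1-3) by (simp only: sum.distrib sum_subtractf sum_distrib_left[symmetric])
  finally have "\<forall>k\<in>{..<d}. (x k - y k)\<^sup>2 = 0" by (subst (asm) sum_nonneg_eq_0_iff) auto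
  then have "(x k - y k)\<^sup>2 = 0" using \<open>k < d\<close> by blast
  then show ?thesis by simp
qed

lemma bij_if_CP_isomorphic:
  assumes fin: "finite (pverts G)" "finite (pverts H)"
    and iso: "cone_isomorphic CP G H"
  shows "\<exists>f. bij_betw f (pverts G) (pverts H) \<and>
    (\<forall>g\<in>pverts G. \<forall>g'\<in>pverts G. rel G g g' = rel H (f g) (f g'))"
proof -
  let ?G = "pverts G" and ?H = "pverts H"
  obtain M where M: "M \<in> CP (?G \<times> ?H)"
    and row: "\<And>g g'. g \<in> ?G \<Longrightarrow> g' \<in> ?G \<Longrightarrow> (\<Sum>h\<in>?H. \<Sum>h'\<in>?H. M (g, h) (g', h')) = 1"
    and col: "\<And>h h'. h \<in> ?H \<Longrightarrow> h' \<in> ?H \<Longrightarrow> (\<Sum>g\<in>?G. \<Sum>g'\<in>?G. M (g, h) (g', h')) = 1"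
    and zero: "\<And>g g' h h'. g \<in> ?G \<Longrightarrow> g' \<in> ?G \<Longrightarrow> h \<in> ?H \<Longrightarrow> h' \<in> ?H \<Longrightarrow>
        rel G g g' \<noteq> rel H h h' \<Longrightarrow> M (g, h) (g', h') = 0"
    using iso unfolding cone_isomorphic_def by blast
  show ?thesis
  proof (cases "?G = {}")
    case True
    \<comment> \<open>For a vertex of \<open>H\<close>, the column condition would equate an empty
      sum with 1.\<close>
    then have "?H = {}" using col by fastforce
    then show ?thesis using True by (simp add: bij_betw_def)
  next
    case False
    then obtain g0 where g0: "g0 \<in> ?G" by blast
    obtain d :: nat and v :: "'a \<times> 'b \<Rightarrow> real vec"
      where v: "\<forall>i\<in>?G \<times> ?H. v i \<in> carrier_vec d \<and> (\<forall>k<d. 0 \<le> v i $ k)"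
        and Mv: "\<forall>i\<in>?G \<times> ?H. \<forall>j\<in>?G \<times> ?H. M i j = v i \<bullet> v j"
      using M unfolding CP_def mem_Collect_eq by (elim exE conjE)
    define x where "x = (\<lambda>g h k. v (g, h) $ k)"
    have x: "0 \<le> x g h k" if "g \<in> ?G" "h \<in> ?H" "k < d" for g h k
      using v that by (auto simp: x_def)
    have Mx: "M (g, h) (g', h') = (\<Sum>k<d. x g h k * x g' h' k)"
      if "g \<in> ?G" "g' \<in> ?G" "h \<in> ?H" "h' \<in> ?H" for g g' h h'
    proof -
      have "dim_vec (v (g', h')) = d" using that v by auto
      then show ?thesis using that by (simp add: Mv scalar_prod_def x_def atLeast0LessThan)
    qed
    define s where "s = (\<lambda>g k. \<Sum>h\<in>?H. x g h k)"
    define t where "t = (\<lambda>h k. \<Sum>g\<in>?G. x g h k)"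
    have ss: "(\<Sum>k<d. s g k * s g' k) = 1" if "g \<in> ?G" "g' \<in> ?G" for g g'
    proof -
      have "(\<Sum>k<d. s g k * s g' k) = (\<Sum>h\<in>?H. \<Sum>h'\<in>?H. \<Sum>k<d. x g h k * x g' h' k)"
        unfolding s_def sum_product by (subst sum.swap, rule sum.cong[OF refl], rule sum.swap)
      then show ?thesis using row[OF that] Mx that by simp
    qed
    have tt: "(\<Sum>k<d. t h k * t h' k) = 1" if "h \<in> ?H" "h' \<in> ?H" for h h'
    proof -
      have "(\<Sum>k<d. t h k * t h' k) = (\<Sum>g\<in>?G. \<Sum>g'\<in>?G. \<Sum>k<d. x g h k * x g' h' k)"
        unfolding t_def sum_product by (subst sum.swap, rule sum.cong[OF refl], rule sum.swap)
      then show ?thesis using col[OF that] Mx that by simp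
    qed
    \<comment> \<open>Such a coordinate exists because \<open>s g0\<close> has norm 1; the
      isomorphism is read off at this coordinate alone.\<close>
    obtain k where k: "k < d" "s g0 k \<noteq> 0"
    proof -
      have "\<exists>k\<in>{..<d}. s g0 k * s g0 k \<noteq> 0"
        using ss[OF g0 g0] sum.neutral[of "{..<d}" "\<lambda>k. s g0 k * s g0 k"]
        by (metis zero_neq_one)
      then show thesis using that by auto
    qed
    have sk: "s g k = s g0 k" if "g \<in> ?G" for g
      using eq_if_unit_products[OF ss[OF that that] ss[OF g0 g0] ss[OF that g0] k(1)] .
    have tk: "t h k = t h' k" if "h \<in> ?H" "h' \<in> ?H" for h h'
      using eq_if_unit_products[OF tt[OF that(1,1)] tt[OF that(2,2)] tt[OF that] k(1)] .
    \<comment> \<open>Summing all entries at \<open>k\<close> by rows and by columns shows that the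
      common column sum is nonzero at \<open>k\<close> as well, so every column has a positive entry
      there.\<close>
    have "(\<Sum>h\<in>?H. t h k) = (\<Sum>g\<in>?G. s g k)" unfolding s_def t_def by (rule sum.swap)
    also have "\<dots> = card ?G * s g0 k" by (simp add: sk)
    also have "\<dots> \<noteq> 0" using k False fin by simp
    finally have sum_t: "(\<Sum>h\<in>?H. t h k) \<noteq> 0" .
    have tk0: "t h k \<noteq> 0" if "h \<in> ?H" for h
    proof
      assume "t h k = 0"
      then have "\<And>h'. h' \<in> ?H \<Longrightarrow> t h' k = 0" using tk that by metis
      then show False using sum_t by simp
    qed
    have ex_h: "\<exists>h\<in>?H. 0 < x g h k" if "g \<in> ?G" for g
    proof (rule ccontr)
      assume "\<not> ?thesis"
      then have "x g h k = 0" if "h \<in> ?H" for h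
        using x[OF \<open>g \<in> ?G\<close> that k(1)] that by force
      then show False using sk[OF that] k by (simp add: s_def)
    qed
    have ex_g: "\<exists>g\<in>?G. 0 < x g h k" if "h \<in> ?H" for h
    proof (rule ccontr)
      assume "\<not> ?thesis"
      then have "x g h k = 0" if "g \<in> ?G" for g
        using x[OF that \<open>h \<in> ?H\<close> k(1)] that by force
      then show False using tk0[OF that] by (simp add: t_def)
    qed
    \<comment> \<open>A vanishing entry of \<open>M\<close> is a sum of nonnegative products, so its
      term at \<open>k\<close> vanishes, which contradicts the positivity of both factors.\<close>
    have rel: "rel G g g' = rel H h h'"
      if "g \<in> ?G" "g' \<in> ?G" "h \<in> ?H" "h' \<in> ?H" "0 < x g h k" "0 < x g' h' k" for g g' h h'
    proof (rule ccontr)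
      assume "\<not> ?thesis"
      then have "(\<Sum>k<d. x g h k * x g' h' k) = 0" using zero Mx that by simp
      then have "\<forall>i\<in>{..<d}. x g h i * x g' h' i = 0"
        using that by (subst (asm) sum_nonneg_eq_0_iff) (auto intro!: mult_nonneg_nonneg x)
      then show False using that k by force
    qed
    obtain f where f: "\<And>g. g \<in> ?G \<Longrightarrow> f g \<in> ?H" "\<And>g. g \<in> ?G \<Longrightarrow> 0 < x g (f g) k"
      using bchoice[of ?G "\<lambda>g h. h \<in> ?H \<and> 0 < x g h k"] ex_h by blast
    have "inj_on f ?G"
    proof
      fix g g' assume g: "g \<in> ?G" "g' \<in> ?G" "f g = f g'"
      then have "rel G g g' = rel H (f g) (f g')" using f(2)[of g] f(2)[of g'] by (intro rel f)
      then show "g = g'" using g by simp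
    qed
    moreover have "h \<in> f ` ?G" if h: "h \<in> ?H" for h
    proof -
      obtain g where g: "g \<in> ?G" "0 < x g h k" using ex_g[OF h] by blast
      \<comment> \<open>Row \<open>g\<close> has only one positive entry at \<open>k\<close>:
        relating \<open>g\<close> to itself forces \<open>Equal\<close> on the side of
        \<open>H\<close>.\<close>
      then have "rel G g g = rel H (f g) h" by (intro rel) (auto simp: f h)
      then have "rel H (f g) h = Equal" by simp
      then have "f g = h" by simp
      then show ?thesis using g by blast
    qed
    ultimately have "bij_betw f ?G ?H" using f by (auto simp: bij_betw_def)
    then show ?thesis using rel f by blast
  qed
qed

section \<open>Square complex matrices\<close>

lemma dim_mat_adjoint [simp]:
  "dim_row (mat_adjoint A) = dim_col A" "dim_col (mat_adjoint A) = dim_row A"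
  by (simp_all add: mat_adjoint_def)

lemma mat_adjoint_carrier [simp]:
  "A \<in> carrier_mat n m \<Longrightarrow> mat_adjoint A \<in> carrier_mat m n"
  by (rule carrier_matI) auto

lemma index_mat_adjoint:
  fixes A :: "complex mat"
  assumes "i < dim_col A" "j < dim_row A"
  shows "mat_adjoint A $$ (i, j) = cnj (A $$ (j, i))"
  using assms unfolding mat_adjoint_def by (subst mat_of_rows_index) auto

context
  fixes d :: nat
begin

abbreviation (input) square :: "complex mat set"
  where "square \<equiv> carrier_mat d d"

lemmas square_closed [simp] =
  mult_carrier_mat[of _ d d _ d] add_carrier_mat[of _ d d] minus_carrier_mat[of _ d d]
  mat_adjoint_carrier[of _ d d] one_carrier_mat[of d] zero_carrier_mat[of d d]
  smult_carrier_mat[of _ d d]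

text \<open>With all dimensions fixed to \<open>d\<close>, the carrier premises reduce to membership
  in \<open>square\<close>. Products are normalised by nesting them to the right.\<close>

lemmas square_algebra =
  assoc_mult_mat[of _ d d _ d _ d] add_mult_distrib_mat[of _ d d _ _ d]
  mult_add_distrib_mat[of _ d d _ d] minus_mult_distrib_mat[of _ d d _ _ d]
  mult_minus_distrib_mat[of _ d d _ d] left_mult_one_mat[of _ d d] right_mult_one_mat[of _ d d]
  left_mult_zero_mat[of _ d d d] right_mult_zero_mat[of _ d d d]
  mult_smult_assoc_mat[of _ d d _ d] mult_smult_distrib[of _ d d _ d]

lemma minus_zero_square: "A \<in> square \<Longrightarrow> A - 0\<^sub>m d d = A"
  by (intro eq_matI) auto

lemma add_minus_cancel:
  "A \<in> square \<Longrightarrow> B \<in> square \<Longrightarrow> (A - B) + (B - A) = 0\<^sub>m d d"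
  by (intro eq_matI) auto

lemma smult_zero_square: "c \<cdot>\<^sub>m 0\<^sub>m d d = (0\<^sub>m d d :: complex mat)"
  by (intro eq_matI) auto

lemmas square_zero =
  left_add_zero_mat[of _ d d] right_add_zero_mat[of _ d d] left_mult_zero_mat[of _ d d d]
  right_mult_zero_mat[of _ d d d] minus_r_inv_mat[of _ d d] minus_zero_square smult_zero_square

text \<open>Once products nest to the right, \<open>A * B\<close> is no longer a subterm; this form
  lets a known value of it be used there.\<close>

lemma mult_assoc_eq:
  assumes "A * B = D" "A \<in> square" "B \<in> square" "X \<in> square"
  shows "A * (B * X) = D * X"
  using assoc_mult_mat[OF assms(2-4)] unfolding assms(1) by (rule sym)

lemma index_mult_square:
  assumes "A \<in> square" "B \<in> square" "i < d" "j < d"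
  shows "(A * B) $$ (i, j) = (\<Sum>k<d. A $$ (i, k) * B $$ (k, j))"
  using assms by (simp add: scalar_prod_def atLeast0LessThan)

lemma index_adjoint_square:
  "A \<in> square \<Longrightarrow> i < d \<Longrightarrow> j < d \<Longrightarrow> mat_adjoint A $$ (i, j) = cnj (A $$ (j, i))"
  by (simp add: index_mat_adjoint)

lemma square_eqI:
  assumes "A \<in> square" "B \<in> square" "\<And>i j. i < d \<Longrightarrow> j < d \<Longrightarrow> A $$ (i, j) = B $$ (i, j)"
  shows "A = B"
  using assms by (intro eq_matI) auto

lemma adjoint_adjoint: "A \<in> square \<Longrightarrow> mat_adjoint (mat_adjoint A) = A"
  by (rule square_eqI) (simp_all add: index_adjoint_square)

lemma adjoint_mult:
  "A \<in> square \<Longrightarrow> B \<in> square \<Longrightarrow> mat_adjoint (A * B) = mat_adjoint B * mat_adjoint A"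
  by (rule square_eqI) (simp_all add: index_adjoint_square index_mult_square mult.commute
      del: index_mult_mat(1))

lemma adjoint_add:
  "A \<in> square \<Longrightarrow> B \<in> square \<Longrightarrow> mat_adjoint (A + B) = mat_adjoint A + mat_adjoint B"
  by (rule square_eqI) (simp_all add: index_adjoint_square)

lemma adjoint_minus:
  "A \<in> square \<Longrightarrow> B \<in> square \<Longrightarrow> mat_adjoint (A - B) = mat_adjoint A - mat_adjoint B"
  by (rule square_eqI) (simp_all add: index_adjoint_square)

lemma adjoint_one: "mat_adjoint (1\<^sub>m d) = (1\<^sub>m d :: complex mat)"
  by (rule square_eqI) (auto simp: index_adjoint_square)

lemma adjoint_zero: "mat_adjoint (0\<^sub>m d d) = (0\<^sub>m d d :: complex mat)"
  by (rule square_eqI) (auto simp: index_adjoint_square)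

lemma adjoint_smult: "A \<in> square \<Longrightarrow> mat_adjoint (c \<cdot>\<^sub>m A) = cnj c \<cdot>\<^sub>m mat_adjoint A"
  by (rule square_eqI) (auto simp: index_adjoint_square)

lemmas adjoint_simps =
  adjoint_adjoint adjoint_mult adjoint_add adjoint_minus adjoint_one adjoint_zero adjoint_smult

section \<open>The trace and the Frobenius norm\<close>

lemma trace_mult:
  assumes "A \<in> square" "B \<in> square"
  shows "mat_trace (A * B) = (\<Sum>i<d. \<Sum>j<d. A $$ (i, j) * B $$ (j, i))"
proof -
  have "mat_trace (A * B) = (\<Sum>i<d. (A * B) $$ (i, i))"
    using assms by (simp add: mat_trace_def del: index_mult_mat(1))
  then show ?thesis using assms by (simp add: index_mult_square del: index_mult_mat(1))
qed

lemma trace_comm: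
  assumes "A \<in> square" "B \<in> square"
  shows "mat_trace (A * B) = mat_trace (B * A)"
  unfolding trace_mult[OF assms] trace_mult[OF assms(2,1)]
  by (subst sum.swap) (simp add: mult.commute)

lemma trace_add:
  "A \<in> square \<Longrightarrow> B \<in> square \<Longrightarrow> mat_trace (A + B) = mat_trace A + mat_trace B"
  by (simp add: mat_trace_def sum.distrib)

lemma trace_minus:
  "A \<in> square \<Longrightarrow> B \<in> square \<Longrightarrow> mat_trace (A - B) = mat_trace A - mat_trace B"
  by (simp add: mat_trace_def sum_subtractf)

lemma trace_smult: "A \<in> square \<Longrightarrow> mat_trace (c \<cdot>\<^sub>m A) = c * mat_trace A"
  by (simp add: mat_trace_def sum_distrib_left)

lemma trace_zero: "mat_trace (0\<^sub>m d d) = 0"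
  by (simp add: mat_trace_def)

lemma trace_one: "mat_trace (1\<^sub>m d) = of_nat d"
  by (simp add: mat_trace_def)

text \<open>This is the squared Frobenius norm of \<open>A\<close>, the form to which the later
  arguments bring a trace to see that it is nonnegative or that a matrix vanishes.\<close>

lemma trace_adjoint_mult_self:
  assumes "A \<in> square"
  shows "mat_trace (mat_adjoint A * A) = of_real (\<Sum>i<d. \<Sum>j<d. (cmod (A $$ (j, i)))\<^sup>2)"
proof -
  have "mat_trace (mat_adjoint A * A) = (\<Sum>i<d. \<Sum>j<d. of_real ((cmod (A $$ (j, i)))\<^sup>2))"
    unfolding trace_mult[OF mat_adjoint_carrier[OF assms] assms]
    by (intro sum.cong refl)
      (simp add: index_adjoint_square[OF assms] complex_norm_square mult.commute del: of_real_power)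
  then show ?thesis by simp
qed

lemma zero_if_trace_zero:
  assumes A: "A \<in> square" and z: "mat_trace (mat_adjoint A * A) = 0"
  shows "A = 0\<^sub>m d d"
proof -
  have "(\<Sum>i<d. \<Sum>j<d. (cmod (A $$ (j, i)))\<^sup>2) = 0"
    using z unfolding trace_adjoint_mult_self[OF A] of_real_eq_0_iff .
  then have *: "\<forall>i\<in>{..<d}. (\<Sum>j<d. (cmod (A $$ (j, i)))\<^sup>2) = 0"
    by (subst (asm) sum_nonneg_eq_0_iff) (auto intro: sum_nonneg)
  have "A $$ (j, i) = 0" if "i < d" "j < d" for i j
  proof -
    have "(\<Sum>j<d. (cmod (A $$ (j, i)))\<^sup>2) = 0" using * that by blast
    then have "\<forall>j\<in>{..<d}. (cmod (A $$ (j, i)))\<^sup>2 = 0"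
      by (subst (asm) sum_nonneg_eq_0_iff) auto
    then show ?thesis using that by auto
  qed
  then show ?thesis using A by (intro square_eqI) auto
qed

lemma zero_if_gram_zero:
  assumes "A \<in> square" and "mat_adjoint A * A = 0\<^sub>m d d"
  shows "A = 0\<^sub>m d d"
  using zero_if_trace_zero[OF assms(1)] assms(2) trace_zero by simp

section \<open>Positive semidefinite matrices and operations that preserve them\<close>

lemma psd_square: "psd d A \<Longrightarrow> A \<in> square"
  and psd_adjoint: "psd d A \<Longrightarrow> mat_adjoint A = A"
  by (simp_all add: psd_def)

lemma mult_vec_cscalar:
  fixes A :: "complex mat"
  assumes A: "A \<in> square" and v: "v \<in> carrier_vec d" and w: "w \<in> carrier_vec d"
  shows "(A *\<^sub>v v) \<bullet>c w = v \<bullet>c (mat_adjoint A *\<^sub>v w)"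
proof -
  have "(A *\<^sub>v v) \<bullet>c w = (\<Sum>i<d. \<Sum>j<d. A $$ (i, j) * v $ j * cnj (w $ i))"
    using A v w
    by (simp add: scalar_prod_def atLeast0LessThan sum_distrib_right)
  also have "\<dots> = (\<Sum>j<d. \<Sum>i<d. A $$ (i, j) * v $ j * cnj (w $ i))" by (rule sum.swap)
  also have "\<dots> = v \<bullet>c (mat_adjoint A *\<^sub>v w)"
    using A v w mat_adjoint_carrier[OF A]
    by (simp add: scalar_prod_def atLeast0LessThan sum_distrib_left index_adjoint_square mult_ac
        del: mat_adjoint_carrier)
  finally show ?thesis .
qed

lemma Re_cscalar_self_nonneg:
  fixes v :: "complex vec"
  shows "0 \<le> Re (v \<bullet>c v)"
proof -
  have "Re (v \<bullet>c v) = (\<Sum>i<dim_vec v. (cmod (v $ i))\<^sup>2)"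
    by (simp add: scalar_prod_def atLeast0LessThan cmod_power2 flip: power2_eq_square)
  then show ?thesis by (simp add: sum_nonneg)
qed

text \<open>The quadratic form at \<open>v\<close> is that of \<open>K\<close> at
  \<open>mat_adjoint X *\<^sub>v v\<close>.\<close>

lemma psd_congruence:
  assumes K: "psd d K" and X: "X \<in> square"
  shows "psd d (X * K * mat_adjoint X)"
proof -
  note [simp] = psd_square[OF K] X
  have "mat_adjoint (X * K * mat_adjoint X) = X * K * mat_adjoint X"
    by (simp add: adjoint_simps psd_adjoint[OF K] square_algebra)
  moreover have "0 \<le> Re ((X * K * mat_adjoint X *\<^sub>v v) \<bullet>c v)" if v: "v \<in> carrier_vec d" for v
  proof -
    have w: "mat_adjoint X *\<^sub>v v \<in> carrier_vec d"
      using v by (intro mult_mat_vec_carrier) auto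
    have "X * K * mat_adjoint X *\<^sub>v v = X *\<^sub>v (K *\<^sub>v (mat_adjoint X *\<^sub>v v))"
      using v w by (simp add: assoc_mult_mat_vec[of _ d d _ d])
    then have "(X * K * mat_adjoint X *\<^sub>v v) \<bullet>c v =
        (K *\<^sub>v (mat_adjoint X *\<^sub>v v)) \<bullet>c (mat_adjoint X *\<^sub>v v)"
      using v w mult_mat_vec_carrier[OF psd_square[OF K] w] by (simp add: mult_vec_cscalar)
    then show ?thesis using K w by (simp add: psd_def)
  qed
  ultimately show ?thesis by (simp add: psd_def)
qed

lemma psd_one: "psd d (1\<^sub>m d)"
  by (simp add: psd_def adjoint_one Re_cscalar_self_nonneg)

lemma psd_gram: "A \<in> square \<Longrightarrow> psd d (A * mat_adjoint A)"
  using psd_congruence[OF psd_one, of A] by (simp add: square_algebra)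

lemma psd_projection: "P \<in> square \<Longrightarrow> mat_adjoint P = P \<Longrightarrow> P * P = P \<Longrightarrow> psd d P"
  using psd_gram[of P] by simp

lemma psd_add:
  assumes "psd d A" "psd d B"
  shows "psd d (A + B)"
proof -
  have "0 \<le> Re (((A + B) *\<^sub>v v) \<bullet>c v)" if "v \<in> carrier_vec d" for v
  proof -
    have "((A + B) *\<^sub>v v) \<bullet>c v = (A *\<^sub>v v) \<bullet>c v + (B *\<^sub>v v) \<bullet>c v"
      using that assms[THEN psd_square]
      by (simp add: add_mult_distrib_mat_vec[of _ d d] add_scalar_prod_distrib[of _ d])
    then show ?thesis using that assms by (simp add: psd_def)
  qed
  then show ?thesis using assms by (simp add: psd_def adjoint_add)
qed

lemma one_smult: "1 \<cdot>\<^sub>m A = (A :: complex mat)"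
  by (rule eq_matI) auto

lemma smult_smult: "c \<cdot>\<^sub>m (e \<cdot>\<^sub>m A) = (c * e) \<cdot>\<^sub>m (A :: complex mat)"
  by (rule eq_matI) auto

lemma psd_smult:
  assumes "psd d A" and "0 \<le> c"
  shows "psd d (complex_of_real c \<cdot>\<^sub>m A)"
proof -
  have "complex_of_real c \<cdot>\<^sub>m A =
      (complex_of_real (sqrt c) \<cdot>\<^sub>m 1\<^sub>m d) * A * mat_adjoint (complex_of_real (sqrt c) \<cdot>\<^sub>m 1\<^sub>m d)"
    using psd_square[OF assms(1)] \<open>0 \<le> c\<close>
    by (simp add: square_algebra adjoint_simps smult_smult flip: of_real_mult)
  then show ?thesis using psd_congruence[OF assms(1), of "complex_of_real (sqrt c) \<cdot>\<^sub>m 1\<^sub>m d"] by simp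
qed

section \<open>Square roots and supports of positive semidefinite matrices\<close>

text \<open>A nonzero Hermitian \<open>K\<close> has nonzero \<open>mat_trace (K * K)\<close>, so
  its triangular form has a nonzero diagonal entry. This is an eigenvalue, and semidefiniteness
  makes it positive. \<open>E\<close> projects onto the line of an eigenvector.\<close>

lemma psd_eigenprojection:
  assumes K: "psd d K" and nz: "K \<noteq> 0\<^sub>m d d"
  obtains E \<mu> where "E \<in> square" "mat_adjoint E = E" "E * E = E" "mat_trace E = 1"
    "K * E = complex_of_real \<mu> \<cdot>\<^sub>m E" "0 < \<mu>"
proof -
  note Ksq = psd_square[OF K] and Kadj = psd_adjoint[OF K]
  obtain as where as: "char_poly K = (\<Prod>a\<leftarrow>as. [:- a, 1:])"
    using char_poly_factorized[OF Ksq] by blast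
  obtain B P Q where BPQ: "schur_decomposition K as = (B, P, Q)"
    by (cases "schur_decomposition K as")
  have sim: "similar_mat_wit K B P Q" and ut: "upper_triangular B" and diag: "diag_mat B = as"
    using schur_decomposition[OF Ksq as BPQ] by auto
  note w = similar_mat_witD2[OF Ksq sim]
  have [simp]: "K \<in> square" "B \<in> square" "P \<in> square" "Q \<in> square" using w by auto
  \<comment> \<open>Similarity preserves the trace of the square, and for triangular
    \<open>B\<close> that trace is the sum of the squared diagonal entries.\<close>
  have "K * K = P * (B * ((Q * P) * (B * Q)))" unfolding w(3) by (simp add: square_algebra)
  also have "\<dots> = P * (B * B * Q)" unfolding w(2) by (simp add: square_algebra)
  also have "mat_trace \<dots> = mat_trace (B * B * (Q * P))"
    by (simp add: trace_comm[of P] square_algebra)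
  also have "\<dots> = mat_trace (B * B)" by (simp add: w(2) square_algebra)
  finally have "mat_trace (B * B) = mat_trace (mat_adjoint K * K)" by (simp add: Kadj)
  then have "mat_trace (B * B) \<noteq> 0" using zero_if_trace_zero[OF Ksq] nz by auto
  moreover have "mat_trace (B * B) = (\<Sum>i<d. B $$ (i, i) * B $$ (i, i))"
  proof -
    have off: "B $$ (i, j) * B $$ (j, i) = 0" if "i < d" "j < d" "j \<noteq> i" for i j
      using that upper_triangularD[OF ut, of i j] upper_triangularD[OF ut, of j i]
        carrier_matD(1)[OF \<open>B \<in> square\<close>]
      by (cases i j rule: linorder_cases) auto
    have "(\<Sum>j<d. B $$ (i, j) * B $$ (j, i)) = B $$ (i, i) * B $$ (i, i)" if "i < d" for i
      using that by (subst sum.remove[of _ i]) (auto simp: off)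
    then show ?thesis by (simp add: trace_mult)
  qed
  ultimately have "(\<Sum>i<d. B $$ (i, i) * B $$ (i, i)) \<noteq> 0" by simp
  then have "\<exists>i\<in>{..<d}. B $$ (i, i) * B $$ (i, i) \<noteq> 0" by (meson sum.neutral)
  then obtain i where i: "i < d" "B $$ (i, i) \<noteq> 0" by auto
  define \<mu> where "\<mu> = B $$ (i, i)"
  have "\<mu> \<in> set as"
    using i carrier_matD(1)[OF \<open>B \<in> square\<close>] unfolding diag[symmetric] \<mu>_def diag_mat_def by auto
  then have "poly (char_poly K) \<mu> = 0" unfolding as by (rule linear_poly_root)
  then obtain v where v: "v \<in> carrier_vec d" "v \<noteq> 0\<^sub>v d" "K *\<^sub>v v = \<mu> \<cdot>\<^sub>v v"
    using eigenvalue_root_char_poly[OF Ksq] carrier_matD[OF Ksq]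
    unfolding eigenvalue_def eigenvector_def by auto
  have Kv: "(\<Sum>k<d. K $$ (i, k) * v $ k) = \<mu> * v $ i" if "i < d" for i
    using arg_cong[OF v(3), of "\<lambda>x. x $ i"] that v(1) Ksq
    by (simp add: scalar_prod_def atLeast0LessThan)
  define n where "n = (\<Sum>k<d. (cmod (v $ k))\<^sup>2)"
  have "n \<noteq> 0"
  proof
    assume "n = 0"
    then have "\<forall>k\<in>{..<d}. (cmod (v $ k))\<^sup>2 = 0"
      unfolding n_def by (subst (asm) sum_nonneg_eq_0_iff) auto
    then have "v = 0\<^sub>v d" using v(1) by (intro eq_vecI) auto
    then show False using v(2) by simp
  qed
  moreover have n: "(\<Sum>k<d. v $ k * cnj (v $ k)) = complex_of_real n"
    unfolding n_def by (simp add: complex_norm_square del: of_real_power)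
  ultimately have n0: "complex_of_real n \<noteq> 0" by simp
  \<comment> \<open>The orthogonal projection onto the span of \<open>v\<close>, where
    \<open>n\<close> is the squared norm of \<open>v\<close>.\<close>
  define E where "E = mat d d (\<lambda>(i, j). v $ i * cnj (v $ j) / complex_of_real n)"
  have E: "E \<in> square" by (simp add: E_def)
  have E_adj: "mat_adjoint E = E"
    using E by (intro square_eqI) (simp_all add: index_adjoint_square, simp add: E_def)
  have E_idem: "E * E = E"
  proof (rule square_eqI)
    fix i j assume ij: "i < d" "j < d"
    have "(E * E) $$ (i, j) =
        (\<Sum>k<d. v $ k * cnj (v $ k)) * (v $ i * cnj (v $ j) / complex_of_real n / complex_of_real n)"
      using ij unfolding index_mult_square[OF E E ij] sum_distrib_right
      by (intro sum.cong) (auto simp: E_def)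
    then show "(E * E) $$ (i, j) = E $$ (i, j)" using ij n0 by (simp add: n E_def)
  qed (use E in auto)
  have E_tr: "mat_trace E = 1"
    using n n0 by (simp add: mat_trace_def E_def flip: sum_divide_distrib)
  have KE: "K * E = \<mu> \<cdot>\<^sub>m E"
  proof (rule square_eqI)
    fix i j assume ij: "i < d" "j < d"
    have "(K * E) $$ (i, j) = (\<Sum>k<d. K $$ (i, k) * v $ k) * (cnj (v $ j) / complex_of_real n)"
      using ij unfolding index_mult_square[OF Ksq E ij] sum_distrib_right
      by (intro sum.cong) (auto simp: E_def)
    then show "(K * E) $$ (i, j) = (\<mu> \<cdot>\<^sub>m E) $$ (i, j)" using ij by (simp add: Kv E_def)
  qed (use E in auto)
  \<comment> \<open>Since \<open>K * E\<close> and \<open>E * K\<close> have equal trace, the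
    eigenvalue is real; the quadratic form at \<open>v\<close> then gives its sign.\<close>
  have "E * K = cnj \<mu> \<cdot>\<^sub>m E"
    using arg_cong[OF KE, of mat_adjoint] E by (simp add: adjoint_simps Kadj E_adj)
  then have "cnj \<mu> = \<mu>"
    using trace_comm[OF Ksq E] by (simp add: KE trace_smult[OF E] E_tr)
  then have \<mu>: "\<mu> = complex_of_real (Re \<mu>)"
    by (simp add: complex_eq_iff)
  have "(K *\<^sub>v v) \<bullet>c v = \<mu> * complex_of_real n"
    using v(1) by (simp add: v(3) n[symmetric] scalar_prod_def atLeast0LessThan sum_distrib_left
        mult.assoc)
  then have "0 \<le> Re \<mu> * n" using K v(1) unfolding psd_def by (subst (asm) \<mu>) auto
  moreover have "0 < n" using \<open>n \<noteq> 0\<close> unfolding n_def by (simp add: less_le sum_nonneg)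
  ultimately have "0 \<le> Re \<mu>" by (simp add: zero_le_mult_iff)
  moreover have "Re \<mu> \<noteq> 0" using \<mu> i by (auto simp: \<mu>_def)
  ultimately have "0 < Re \<mu>" by simp
  moreover have "K * E = complex_of_real (Re \<mu>) \<cdot>\<^sub>m E" using KE \<mu> by simp
  ultimately show ?thesis by (intro that[OF E E_adj E_idem E_tr])
qed

lemma eq_if_minus_eq_zero:
  assumes "A \<in> square" "B \<in> square" "A - B = 0\<^sub>m d d"
  shows "A = B"
proof (rule square_eqI[OF assms(1,2)])
  fix i j assume "i < d" "j < d"
  then have "(A - B) $$ (i, j) = 0" unfolding assms(3) by simp
  then show "A $$ (i, j) = B $$ (i, j)" using assms(1,2) \<open>i < d\<close> \<open>j < d\<close> by simp
qed

text \<open>The complement of \<open>P\<close> is again a projection, so its trace is a squared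
  Frobenius norm.\<close>

lemma trace_projection_le:
  assumes P: "P \<in> square" "mat_adjoint P = P" "P * P = P"
  shows "Re (mat_trace P) \<le> d"
proof -
  let ?Q = "1\<^sub>m d - P"
  have "mat_adjoint ?Q * ?Q = ?Q" using P by (simp add: adjoint_simps square_algebra square_zero)
  then have "mat_trace ?Q = of_real (\<Sum>i<d. \<Sum>j<d. (cmod (?Q $$ (j, i)))\<^sup>2)"
    using trace_adjoint_mult_self[of ?Q] P by simp
  then have "0 \<le> Re (mat_trace ?Q)" by (simp add: sum_nonneg del: index_minus_mat)
  then show ?thesis using P by (simp add: trace_minus trace_one)
qed

text \<open>
  Eigenprojections are split off one at a time; the trace of their sum bounds the number of steps.
  The factor \<open>X\<close> in \<open>P = K * X\<close> makes \<open>P\<close> vanish against everything orthogonal to \<open>K\<close>.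
\<close>

lemma psd_sqrt_support:
  assumes K: "psd d K"
  obtains R P X where "psd d R" "R * R = K" "P \<in> square" "mat_adjoint P = P" "P * P = P"
    "K * P = K" "X \<in> square" "P = K * X"
proof -
  note Ksq [simp] = psd_square[OF K] and Kadj = psd_adjoint[OF K]
  \<comment> \<open>Invariant of the splitting: \<open>P\<close> collects the eigenprojections found
    so far, \<open>R\<close> is the square root of the part of \<open>K\<close> on the range of
    \<open>P\<close>, and \<open>X\<close> inverts \<open>K\<close> there.\<close>
  define partial where "partial = (\<lambda>R P X. psd d R \<and> R * R = K * P \<and> R * P = R \<and> P \<in> square \<and>
    mat_adjoint P = P \<and> P * P = P \<and> K * P = P * K \<and> X \<in> square \<and> P = K * X)"
  have step: "\<exists>R P X. partial R P X \<and> (K * P = K \<or> mat_trace P = of_nat n)" for n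
  proof (induction n)
    case 0
    have "partial (0\<^sub>m d d) (0\<^sub>m d d) (0\<^sub>m d d)"
      using psd_gram[of "0\<^sub>m d d"] by (simp add: partial_def adjoint_zero square_zero)
    then show ?case using trace_zero by (metis of_nat_0)
  next
    case (Suc n)
    then obtain R P X where part: "partial R P X" and n: "K * P = K \<or> mat_trace P = of_nat n"
      by blast
    show ?case
    proof (cases "K * P = K")
      case True
      then show ?thesis using part by blast
    next
      case False
      have R: "psd d R" "R * R = K * P" "R * P = R" and P: "P \<in> square" "mat_adjoint P = P" "P * P = P"
        and KP: "K * P = P * K" and X: "X \<in> square" "K * X = P"
        using part by (auto simp: partial_def)
      note [simp] = P X(1) psd_square[OF R(1)]
      let ?K = "K - K * P"
      have PK: "P * ?K = 0\<^sub>m d d"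
        by (simp add: square_algebra KP square_zero mult_assoc_eq[OF P(3)])
      have KPP: "?K * P = 0\<^sub>m d d"
        by (simp add: square_algebra square_zero)
      \<comment> \<open>The remainder \<open>K - K * P\<close> is the compression of
        \<open>K\<close> to the complement of \<open>P\<close>, hence positive semidefinite, and the
        next eigenprojection is taken from it.\<close>
      have "(1\<^sub>m d - P) * K * mat_adjoint (1\<^sub>m d - P) = ?K * (1\<^sub>m d - P)"
        by (simp add: adjoint_simps minus_mult_distrib_mat[of _ d d _ _ d] left_mult_one_mat[of _ d d]
            flip: KP)
      also have "\<dots> = ?K - ?K * P"
        by (simp add: mult_minus_distrib_mat[of _ d d _ d] right_mult_one_mat[of _ d d])
      also have "\<dots> = ?K" by (simp add: KPP square_zero)
      finally have "psd d ?K" using psd_congruence[OF K, of "1\<^sub>m d - P"] by simp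
      moreover have "?K \<noteq> 0\<^sub>m d d" using False eq_if_minus_eq_zero[of K "K * P"] by auto
      ultimately obtain E \<mu> where E [simp]: "E \<in> square" "mat_adjoint E = E" "E * E = E"
        and Etr: "mat_trace E = 1" and KE': "?K * E = complex_of_real \<mu> \<cdot>\<^sub>m E" and \<mu>: "0 < \<mu>"
        by (rule psd_eigenprojection)
      \<comment> \<open>\<open>P\<close> annihilates the remainder, so the new eigenprojection is
        orthogonal to \<open>P\<close>; dividing by the eigenvalue is possible because it is
        positive.\<close>
      have "complex_of_real \<mu> \<cdot>\<^sub>m (P * E) = P * (?K * E)"
        by (simp add: KE' mult_smult_distrib[of _ d d _ d])
      also have "\<dots> = 0\<^sub>m d d" by (simp add: mult_assoc_eq[OF PK] square_zero)
      finally have "complex_of_real (1 / \<mu>) \<cdot>\<^sub>m (complex_of_real \<mu> \<cdot>\<^sub>m (P * E)) = 0\<^sub>m d d"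
        by (simp add: square_zero)
      then have PE: "P * E = 0\<^sub>m d d" using \<mu> by (simp add: smult_smult one_smult)
      have EP: "E * P = 0\<^sub>m d d" using arg_cong[OF PE, of mat_adjoint] by (simp add: adjoint_simps)
      have KE: "K * E = complex_of_real \<mu> \<cdot>\<^sub>m E"
        using KE' by (simp add: square_algebra PE square_zero)
      have EK: "E * K = complex_of_real \<mu> \<cdot>\<^sub>m E"
        using arg_cong[OF KE, of mat_adjoint] by (simp add: adjoint_simps Kadj)
      have PR: "P * R = R"
        using arg_cong[OF R(3), of mat_adjoint] by (simp add: adjoint_simps psd_adjoint[OF R(1)])
      have RE: "R * E = 0\<^sub>m d d"
        using assoc_mult_mat[of R d d P d E d] by (simp add: R(3) PE square_zero)
      have ER: "E * R = 0\<^sub>m d d"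
        using assoc_mult_mat[of E d d P d R d] by (simp add: PR EP square_zero)
      let ?s = "complex_of_real (sqrt \<mu>)"
      have ss: "?s * ?s = complex_of_real \<mu>" using \<mu> by (simp flip: of_real_mult)
      \<comment> \<open>On the range of \<open>E\<close> the matrix \<open>K\<close> is a scalar, so
        its root and its inverse there are the root and the inverse of that scalar.\<close>
      let ?R = "R + ?s \<cdot>\<^sub>m E" and ?P = "P + E" and ?X = "X + complex_of_real (1 / \<mu>) \<cdot>\<^sub>m E"
      have "psd d ?R" using \<mu> by (intro psd_add R(1) psd_smult psd_projection E) auto
      moreover have "?R * ?R = K * ?P"
        by (simp add: square_algebra R(2) RE ER KE square_zero smult_smult ss)
      moreover have "?R * ?P = ?R"
        by (simp add: square_algebra R(3) RE EP square_zero)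
      moreover have "?P * ?P = ?P" by (simp add: square_algebra PE EP square_zero)
      moreover have "K * ?P = ?P * K" by (simp add: square_algebra KE EK KP)
      moreover have "?P = K * ?X"
        using \<mu> by (simp add: square_algebra X(2) KE smult_smult one_smult flip: of_real_mult)
      moreover have "mat_adjoint ?P = ?P" "?P \<in> square" "?X \<in> square"
        by (simp_all add: adjoint_add)
      ultimately have "partial ?R ?P ?X" unfolding partial_def by (intro conjI)
      moreover have "mat_trace ?P = of_nat (Suc n)" using False n by (simp add: trace_add Etr)
      ultimately show ?thesis by blast
    qed
  qed
  \<comment> \<open>A trace of \<open>Suc d\<close> exceeds the bound for a projection, so after
    that many steps \<open>P\<close> covers all of \<open>K\<close>.\<close>
  obtain R P X where part: "partial R P X" and *: "K * P = K \<or> mat_trace P = of_nat (Suc d)"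
    using step by blast
  have "K * P = K"
    using * trace_projection_le[of P] part by (auto simp: partial_def)
  then show ?thesis using that part by (auto simp: partial_def)
qed

lemma psd_factor:
  assumes "psd d K"
  obtains R where "R \<in> square" "K = R * mat_adjoint R"
proof -
  obtain R P X where "psd d R" "R * R = K" by (rule psd_sqrt_support[OF assms])
  then show ?thesis using that[of R] by (simp add: psd_square psd_adjoint)
qed

section \<open>Vanishing traces and commutation\<close>

lemma trace_gram_nonneg: "A \<in> square \<Longrightarrow> 0 \<le> Re (mat_trace (mat_adjoint A * A))"
  by (simp add: trace_adjoint_mult_self sum_nonneg)

lemma zero_if_Re_trace_zero:
  assumes A: "A \<in> square" and z: "Re (mat_trace (mat_adjoint A * A)) = 0"
  shows "A = 0\<^sub>m d d"
  using z unfolding trace_adjoint_mult_self[OF A] Re_complex_of_real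
  by (intro zero_if_trace_zero[OF A]) (simp only: trace_adjoint_mult_self[OF A] of_real_0)

text \<open>With \<open>A = C C\<^sup>*\<close> and \<open>B = D D\<^sup>*\<close>, the trace is the squared norm of \<open>C\<^sup>* S D\<close>.\<close>

lemma psd_sandwich_eq_zero:
  assumes A: "psd d A" and B: "psd d B" and S: "S \<in> square"
    and z: "mat_trace (mat_adjoint S * A * S * B) = 0"
  shows "A * S * B = 0\<^sub>m d d"
proof -
  obtain C where C [simp]: "C \<in> square" and CA: "A = C * mat_adjoint C" by (rule psd_factor[OF A])
  obtain D where D [simp]: "D \<in> square" and DB: "B = D * mat_adjoint D" by (rule psd_factor[OF B])
  note CD = CA DB
  note [simp] = S
  let ?Z = "mat_adjoint C * S * D"
  have "mat_adjoint S * A * S * B = (mat_adjoint S * C * ?Z) * mat_adjoint D"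
    by (simp add: CD square_algebra)
  then have "mat_trace (mat_adjoint S * A * S * B) = mat_trace (mat_adjoint D * (mat_adjoint S * C * ?Z))"
    by (simp add: trace_comm[of _ "mat_adjoint D"])
  also have "mat_adjoint D * (mat_adjoint S * C * ?Z) = mat_adjoint ?Z * ?Z"
    by (simp add: adjoint_simps square_algebra)
  finally have "?Z = 0\<^sub>m d d" using zero_if_trace_zero[of ?Z] z by simp
  moreover have "A * S * B = C * ?Z * mat_adjoint D" by (simp add: CD square_algebra)
  ultimately show ?thesis by (simp add: square_zero)
qed

text \<open>Factoring both matrices by \<open>psd_factor\<close> and shifting cyclically turns the
  trace into a squared Frobenius norm. A member of \<open>CSP\<close> has real entries, so a Gram
  matrix of traces needs this.\<close>

lemma trace_mult_psd_real:
  assumes A: "psd d A" and B: "psd d B"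
  shows "complex_of_real (Re (mat_trace (A * B))) = mat_trace (A * B)"
proof -
  obtain C where C [simp]: "C \<in> square" and CA: "A = C * mat_adjoint C" by (rule psd_factor[OF A])
  obtain D where D [simp]: "D \<in> square" and DB: "B = D * mat_adjoint D" by (rule psd_factor[OF B])
  note CD = CA DB
  let ?Z = "mat_adjoint C * D"
  have "A * B = (C * ?Z) * mat_adjoint D" by (simp add: CD square_algebra)
  then have "mat_trace (A * B) = mat_trace (mat_adjoint D * (C * ?Z))"
    by (simp add: trace_comm[of _ "mat_adjoint D"])
  also have "mat_adjoint D * (C * ?Z) = mat_adjoint ?Z * ?Z"
    by (simp add: adjoint_simps square_algebra)
  finally show ?thesis by (simp add: trace_adjoint_mult_self[of ?Z])
qed

text \<open>The case \<open>S = 1\<close> of \<open>psd_sandwich_eq_zero\<close>; it turns zero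
  entries of the Gram matrix into vanishing products.\<close>

lemma psd_mult_eq_zero:
  assumes "psd d A" "psd d B" "mat_trace (A * B) = 0"
  shows "A * B = 0\<^sub>m d d"
  using psd_sandwich_eq_zero[OF assms(1,2), of "1\<^sub>m d"] assms psd_square
  by (simp add: adjoint_one square_algebra)

text \<open>The traces of \<open>X\<^sup>* R X\<close> and \<open>X\<^sup>* X R\<close> are nonnegative and add up to 0.\<close>

lemma psd_anticommute:
  assumes R: "psd d R" and X [simp]: "X \<in> square" and anti: "R * X + X * R = 0\<^sub>m d d"
  shows "R * X = 0\<^sub>m d d" "X * R = 0\<^sub>m d d"
proof -
  obtain C where C [simp]: "C \<in> square" and RC: "R = C * mat_adjoint C"
    by (rule psd_factor[OF R])
  note [simp] = psd_square[OF R]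
  have RX: "mat_adjoint X * (R * X) = mat_adjoint (mat_adjoint C * X) * (mat_adjoint C * X)"
    by (simp add: RC adjoint_simps square_algebra)
  have "mat_adjoint X * (X * R) = (mat_adjoint X * (X * C)) * mat_adjoint C"
    by (simp add: RC square_algebra)
  then have "mat_trace (mat_adjoint X * (X * R)) = mat_trace (mat_adjoint C * (mat_adjoint X * (X * C)))"
    by (simp add: trace_comm[of _ "mat_adjoint C"])
  also have "mat_adjoint C * (mat_adjoint X * (X * C)) = mat_adjoint (X * C) * (X * C)"
    by (simp add: adjoint_simps square_algebra)
  finally have XR: "mat_trace (mat_adjoint X * (X * R)) = mat_trace (mat_adjoint (X * C) * (X * C))" .
  have "mat_trace (mat_adjoint X * (R * X)) + mat_trace (mat_adjoint X * (X * R)) =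
      mat_trace (mat_adjoint X * (R * X + X * R))"
    by (simp add: mult_add_distrib_mat[of _ d d _ d] trace_add)
  also have "\<dots> = 0" by (simp add: anti square_zero trace_zero)
  finally have sum: "mat_trace (mat_adjoint (mat_adjoint C * X) * (mat_adjoint C * X)) +
      mat_trace (mat_adjoint (X * C) * (X * C)) = 0"
    unfolding RX XR .
  define Y where "Y = mat_adjoint C * X"
  define Z where "Z = X * C"
  have YZ [simp]: "Y \<in> square" "Z \<in> square" by (simp_all add: Y_def Z_def)
  have sum: "mat_trace (mat_adjoint Y * Y) + mat_trace (mat_adjoint Z * Z) = 0"
    using sum by (simp only: Y_def Z_def)
  have "Re (mat_trace (mat_adjoint Y * Y)) + Re (mat_trace (mat_adjoint Z * Z)) = 0"
    using arg_cong[OF sum, of Re] by simp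
  then have "Re (mat_trace (mat_adjoint Y * Y)) = 0" "Re (mat_trace (mat_adjoint Z * Z)) = 0"
    using trace_gram_nonneg[OF YZ(1)] trace_gram_nonneg[OF YZ(2)] by linarith+
  then have "Y = 0\<^sub>m d d" and "Z = 0\<^sub>m d d"
    using zero_if_Re_trace_zero YZ by metis+
  moreover have "R * X = C * Y" "X * R = Z * mat_adjoint C"
    by (simp_all add: RC Y_def Z_def square_algebra)
  ultimately show "R * X = 0\<^sub>m d d" "X * R = 0\<^sub>m d d" by (simp_all add: square_zero)
qed

text \<open>The commutator of \<open>R\<close> and \<open>B\<close> anticommutes with \<open>R\<close>.\<close>

lemma psd_commute_if_square_commutes:
  assumes R: "psd d R" and B: "B \<in> square" "mat_adjoint B = B"
    and comm: "R * (R * B) = B * (R * R)"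
  shows "R * B = B * R"
proof -
  note [simp] = psd_square[OF R] B
  define X where "X = R * B - B * R"
  have X [simp]: "X \<in> square" by (simp add: X_def)
  have "R * X = R * (R * B) - R * (B * R)"
    by (simp add: X_def mult_minus_distrib_mat[of _ d d _ d])
  moreover have "X * R = R * (B * R) - R * (R * B)"
    by (simp add: X_def minus_mult_distrib_mat[of _ d d _ _ d] assoc_mult_mat[of _ d d _ d _ d] comm)
  ultimately have "R * X + X * R = 0\<^sub>m d d" by (simp add: add_minus_cancel)
  note zero = psd_anticommute[OF R X this]
  have XaR: "mat_adjoint X * R = 0\<^sub>m d d"
    using arg_cong[OF zero(1), of mat_adjoint]
    by (simp add: adjoint_mult adjoint_zero psd_adjoint[OF R])
  have RXa: "R * mat_adjoint X = 0\<^sub>m d d"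
    using arg_cong[OF zero(2), of mat_adjoint]
    by (simp add: adjoint_mult adjoint_zero psd_adjoint[OF R])
  \<comment> \<open>Expanding the second factor gives one term containing
    \<open>mat_adjoint X * R\<close> and one that contains \<open>R * mat_adjoint X\<close> after a
    cyclic shift under the trace; both vanish.\<close>
  have "mat_adjoint X * X = mat_adjoint X * (R * B) - mat_adjoint X * (B * R)"
    by (subst (2) X_def) (rule mult_minus_distrib_mat[of _ d d _ d], simp_all)
  also have "mat_adjoint X * (R * B) = 0\<^sub>m d d"
    by (simp add: mult_assoc_eq[OF XaR] square_zero)
  finally have "mat_trace (mat_adjoint X * X) = - mat_trace ((mat_adjoint X * B) * R)"
    by (simp add: trace_minus trace_zero assoc_mult_mat[of _ d d _ d _ d])
  also have "mat_trace ((mat_adjoint X * B) * R) = mat_trace (R * (mat_adjoint X * B))"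
    by (simp add: trace_comm[of _ R])
  also have "R * (mat_adjoint X * B) = 0\<^sub>m d d"
    by (simp add: mult_assoc_eq[OF RXa] square_zero)
  finally have "X = 0\<^sub>m d d" by (intro zero_if_trace_zero X) (simp add: trace_zero)
  then show ?thesis using eq_if_minus_eq_zero[of "R * B" "B * R"] by (simp add: X_def)
qed

text \<open>Transposing \<open>R * mat_adjoint R\<close> gives a product of the same shape for the
  entrywise conjugate of \<open>R\<close>.\<close>

lemma psd_transpose:
  assumes "psd d A"
  shows "psd d (transpose_mat A)"
proof -
  obtain R where R: "R \<in> square" "A = R * mat_adjoint R" using psd_factor[OF assms] .
  have "mat_adjoint (transpose_mat (mat_adjoint R)) = transpose_mat R"
    using R(1) by (intro square_eqI) (auto simp: index_adjoint_square index_mat_adjoint)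
  then have "transpose_mat A = transpose_mat (mat_adjoint R) * mat_adjoint (transpose_mat (mat_adjoint R))"
    unfolding R(2) using R(1) by (simp add: transpose_mult[of _ d d _ d])
  then show ?thesis using psd_gram[of "transpose_mat (mat_adjoint R)"] R(1) by simp
qed

section \<open>Sums of matrices, states and correlations\<close>

text \<open>Entrywise as in \<open>povm\<close>, so that completeness of a measurement reads
  \<open>sum_mat Y P = 1\<^sub>m d\<close>.\<close>

definition sum_mat :: "'y set \<Rightarrow> ('y \<Rightarrow> complex mat) \<Rightarrow> complex mat"
  where "sum_mat Y F = mat d d (\<lambda>ij. \<Sum>y\<in>Y. F y $$ ij)"

lemma sum_mat_square [simp]: "sum_mat Y F \<in> square"
  by (simp add: sum_mat_def)

lemma index_sum_mat: "i < d \<Longrightarrow> j < d \<Longrightarrow> sum_mat Y F $$ (i, j) = (\<Sum>y\<in>Y. F y $$ (i, j))"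
  by (simp add: sum_mat_def)

lemma sum_mat_cong: "(\<And>y. y \<in> Y \<Longrightarrow> F y = F' y) \<Longrightarrow> sum_mat Y F = sum_mat Y F'"
  by (simp add: sum_mat_def)

lemma sum_mat_mult:
  assumes F: "\<And>y. y \<in> Y \<Longrightarrow> F y \<in> square" and A: "A \<in> square"
  shows "sum_mat Y F * A = sum_mat Y (\<lambda>y. F y * A)"
proof (rule square_eqI)
  fix i j assume ij: "i < d" "j < d"
  have "(sum_mat Y F * A) $$ (i, j) = (\<Sum>k<d. \<Sum>y\<in>Y. F y $$ (i, k) * A $$ (k, j))"
    using ij by (simp add: index_mult_square[OF _ A] index_sum_mat sum_distrib_right del: index_mult_mat(1))
  also have "\<dots> = (\<Sum>y\<in>Y. (F y * A) $$ (i, j))"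
    by (subst sum.swap) (intro sum.cong refl index_mult_square[OF F A ij, symmetric])
  finally show "(sum_mat Y F * A) $$ (i, j) = sum_mat Y (\<lambda>y. F y * A) $$ (i, j)"
    using ij by (simp add: index_sum_mat)
qed (use A in simp_all)

lemma mult_sum_mat:
  assumes F: "\<And>y. y \<in> Y \<Longrightarrow> F y \<in> square" and A: "A \<in> square"
  shows "A * sum_mat Y F = sum_mat Y (\<lambda>y. A * F y)"
proof (rule square_eqI)
  fix i j assume ij: "i < d" "j < d"
  have "(A * sum_mat Y F) $$ (i, j) = (\<Sum>k<d. \<Sum>y\<in>Y. A $$ (i, k) * F y $$ (k, j))"
    using ij by (simp add: index_mult_square[OF A] index_sum_mat sum_distrib_left del: index_mult_mat(1))
  also have "\<dots> = (\<Sum>y\<in>Y. (A * F y) $$ (i, j))"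
    by (subst sum.swap) (intro sum.cong refl index_mult_square[OF A F ij, symmetric])
  finally show "(A * sum_mat Y F) $$ (i, j) = sum_mat Y (\<lambda>y. A * F y) $$ (i, j)"
    using ij by (simp add: index_sum_mat)
qed (use A in simp_all)

lemma adjoint_sum_mat:
  assumes "\<And>y. y \<in> Y \<Longrightarrow> F y \<in> square"
  shows "mat_adjoint (sum_mat Y F) = sum_mat Y (\<lambda>y. mat_adjoint (F y))"
  using assms by (intro square_eqI) (simp_all add: index_adjoint_square index_sum_mat)

lemma transpose_sum_mat:
  assumes "\<And>y. y \<in> Y \<Longrightarrow> F y \<in> square"
  shows "transpose_mat (sum_mat Y F) = sum_mat Y (\<lambda>y. transpose_mat (F y))"
proof (rule square_eqI)
  fix i j assume ij: "i < d" "j < d"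
  have "transpose_mat (F y) $$ (i, j) = F y $$ (j, i)" if "y \<in> Y" for y
    using assms[OF that] ij by simp
  then show "transpose_mat (sum_mat Y F) $$ (i, j) = sum_mat Y (\<lambda>y. transpose_mat (F y)) $$ (i, j)"
    using ij carrier_matD[OF sum_mat_square[of Y F]] by (simp add: index_sum_mat)
qed auto

lemma trace_sum_mat:
  assumes "\<And>y. y \<in> Y \<Longrightarrow> F y \<in> square"
  shows "mat_trace (sum_mat Y F) = (\<Sum>y\<in>Y. mat_trace (F y))"
proof -
  have "mat_trace (sum_mat Y F) = (\<Sum>i<d. \<Sum>y\<in>Y. F y $$ (i, i))"
    by (simp add: mat_trace_def sum_mat_def)
  also have "\<dots> = (\<Sum>y\<in>Y. \<Sum>i<d. F y $$ (i, i))" by (rule sum.swap)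
  also have "\<dots> = (\<Sum>y\<in>Y. mat_trace (F y))"
    using assms by (intro sum.cong) (auto simp: mat_trace_def)
  finally show ?thesis .
qed

lemma sum_mat_single:
  assumes "finite Y" "y0 \<in> Y" "F y0 \<in> square" "\<And>y. y \<in> Y \<Longrightarrow> y \<noteq> y0 \<Longrightarrow> F y = 0\<^sub>m d d"
  shows "sum_mat Y F = F y0"
proof (rule square_eqI)
  fix i j assume ij: "i < d" "j < d"
  have "F y $$ (i, j) = 0" if "y \<in> Y - {y0}" for y
    using assms(4)[of y] that ij by simp
  then show "sum_mat Y F $$ (i, j) = F y0 $$ (i, j)"
    using ij sum.remove[OF assms(1,2), of "\<lambda>y. F y $$ (i, j)"] by (simp add: index_sum_mat)
qed (use assms in simp_all)

lemma povm_iff: "povm d Y P \<longleftrightarrow> (\<forall>y\<in>Y. psd d (P y)) \<and> sum_mat Y P = 1\<^sub>m d"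
  by (simp add: povm_def sum_mat_def)

text \<open>The vector \<open>\<psi> \<in> \<complex>\<^sup>d \<otimes> \<complex>\<^sup>d\<close> as a matrix, with \<open>S\<^bsub>ij\<^esub>\<close> the coefficient of \<open>e\<^sub>i \<otimes> e\<^sub>j\<close>.\<close>

definition mat_of_state :: "complex vec \<Rightarrow> complex mat"
  where "mat_of_state \<psi> = mat d d (\<lambda>(i, j). \<psi> $ (i * d + j))"

definition state_of_mat :: "complex mat \<Rightarrow> complex vec"
  where "state_of_mat S = vec (d * d) (\<lambda>k. S $$ (k div d, k mod d))"

lemma mat_of_state_square [simp]: "mat_of_state \<psi> \<in> square"
  by (simp add: mat_of_state_def)

lemma pair_index_less: "i < d \<Longrightarrow> j < d \<Longrightarrow> i * d + j < d * d"
  by (metis Suc_leI add.commute add_less_cancel_left less_le_trans mult_Suc mult_le_mono1)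

lemma mat_of_state_of_mat: "S \<in> square \<Longrightarrow> mat_of_state (state_of_mat S) = S"
  by (rule square_eqI) (simp_all add: mat_of_state_def state_of_mat_def pair_index_less)

lemma sum_pair_index:
  "(\<Sum>k<d * d. f k) = (\<Sum>i<d. \<Sum>j<d. f (i * d + j) :: complex)"
proof -
  have "(\<Sum>i<d. \<Sum>j<d. f (i * d + j)) = (\<Sum>(i, j)\<in>{..<d} \<times> {..<d}. f (i * d + j))"
    by (rule sum.cartesian_product)
  also have "\<dots> = (\<Sum>k<d * d. f k)"
  proof (rule sum.reindex_bij_witness[where j = "\<lambda>(i, j). i * d + j" and i = "\<lambda>k. (k div d, k mod d)"])
    fix k assume "k \<in> {..<d * d}"
    then have k: "k < d * d" and "d > 0" by (auto intro: Nat.gr0I)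
    then show "(k div d, k mod d) \<in> {..<d} \<times> {..<d}" by (simp add: less_mult_imp_div_less)
    show "(case (k div d, k mod d) of (i, j) \<Rightarrow> i * d + j) = k" by simp
  qed (auto simp: pair_index_less)
  finally show ?thesis by simp
qed

lemma state_inner_product:
  assumes "\<psi> \<in> carrier_vec (d * d)"
  shows "\<psi> \<bullet>c \<psi> = mat_trace (mat_adjoint (mat_of_state \<psi>) * mat_of_state \<psi>)"
proof -
  have "\<psi> \<bullet>c \<psi> = (\<Sum>k<d * d. \<psi> $ k * cnj (\<psi> $ k))"
    using assms by (simp add: scalar_prod_def atLeast0LessThan)
  also have "\<dots> = (\<Sum>i<d. \<Sum>j<d. \<psi> $ (i * d + j) * cnj (\<psi> $ (i * d + j)))"
    by (rule sum_pair_index)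
  also have "\<dots> = mat_trace (mat_adjoint (mat_of_state \<psi>) * mat_of_state \<psi>)"
    by (subst sum.swap)
      (simp add: trace_mult index_adjoint_square mult.commute mat_of_state_def)
  finally show ?thesis .
qed

text \<open>When states are read as matrices, \<open>kronecker A B\<close> sends \<open>S\<close> to
  \<open>A * S * transpose_mat B\<close>, and the inner product becomes the trace pairing. This is
  the source of the transposes of Bob's operators.\<close>

lemma correlation_eq_trace:
  assumes \<psi>: "\<psi> \<in> carrier_vec (d * d)" and A: "A \<in> square" and B: "B \<in> square"
  shows "(kronecker A B *\<^sub>v \<psi>) \<bullet>c \<psi> =
    mat_trace (mat_adjoint (mat_of_state \<psi>) * A * mat_of_state \<psi> * transpose_mat B)"
proof -
  let ?S = "mat_of_state \<psi>"
  have S: "?S $$ (i, j) = \<psi> $ (i * d + j)" if "i < d" "j < d" for i j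
    using that by (simp add: mat_of_state_def)
  have BT: "transpose_mat B \<in> square" using B by simp
  have entry: "(kronecker A B *\<^sub>v \<psi>) $ (i * d + j) = (A * ?S * transpose_mat B) $$ (i, j)"
    if ij: "i < d" "j < d" for i j
  proof -
    have "(kronecker A B *\<^sub>v \<psi>) $ (i * d + j) =
        (\<Sum>k<d * d. A $$ (i, k div d) * B $$ (j, k mod d) * \<psi> $ k)"
      using \<psi> A B ij by (simp add: kronecker_def scalar_prod_def atLeast0LessThan pair_index_less)
    also have "\<dots> = (\<Sum>k<d. \<Sum>l<d. A $$ (i, k) * B $$ (j, l) * ?S $$ (k, l))"
      by (subst sum_pair_index) (simp add: S)
    also have "\<dots> = (\<Sum>l<d. (A * ?S) $$ (i, l) * transpose_mat B $$ (l, j))"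
      using ij B by (subst sum.swap, intro sum.cong refl)
        (simp add: index_mult_square[OF A mat_of_state_square] sum_distrib_left mult_ac
          del: index_mult_mat(1))
    also have "\<dots> = (A * ?S * transpose_mat B) $$ (i, j)"
      using A BT ij by (intro index_mult_square[symmetric]) auto
    finally show ?thesis .
  qed
  have dim: "dim_vec (kronecker A B *\<^sub>v \<psi>) = d * d" using A B by (simp add: kronecker_def)
  have "(kronecker A B *\<^sub>v \<psi>) \<bullet>c \<psi> = (\<Sum>k<d * d. (kronecker A B *\<^sub>v \<psi>) $ k * cnj (\<psi> $ k))"
    using \<psi> by (simp add: scalar_prod_def atLeast0LessThan del: index_mult_mat_vec)
  also have "\<dots> = (\<Sum>i<d. \<Sum>j<d. (A * ?S * transpose_mat B) $$ (i, j) * cnj (?S $$ (i, j)))"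
    by (subst sum_pair_index) (simp add: entry S del: index_mult_mat index_mult_mat_vec)
  also have "\<dots> = (\<Sum>j<d. \<Sum>i<d. mat_adjoint ?S $$ (j, i) * (A * ?S * transpose_mat B) $$ (i, j))"
    by (subst sum.swap) (simp add: index_adjoint_square mult.commute del: index_mult_mat)
  also have "\<dots> = mat_trace (mat_adjoint ?S * (A * ?S * transpose_mat B))"
    using A BT by (intro trace_mult[symmetric]) auto
  also have "mat_adjoint ?S * (A * ?S * transpose_mat B) = mat_adjoint ?S * A * ?S * transpose_mat B"
    using A BT by (simp add: square_algebra)
  finally show ?thesis .
qed

text \<open>The Gram matrix of \<open>R * (Z - W)\<close> contains the factor
  \<open>R * (R * (Z - W))\<close>, which is zero. This replaces inverting a possibly singular
  \<open>R\<close>.\<close>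

lemma psd_cancel:
  assumes R: "psd d R" and Z: "Z \<in> square" and W: "W \<in> square"
    and eq: "R * (R * Z) = R * (R * W)"
  shows "R * Z = R * W"
proof -
  note [simp] = psd_square[OF R] Z W
  have "mat_adjoint (R * (Z - W)) * (R * (Z - W)) = mat_adjoint (Z - W) * (R * (R * (Z - W)))"
    by (simp add: adjoint_mult psd_adjoint[OF R] assoc_mult_mat[of _ d d _ d _ d])
  also have "R * (R * (Z - W)) = R * (R * Z) - R * (R * W)"
    by (simp add: mult_minus_distrib_mat[of _ d d _ d])
  also have "mat_adjoint (Z - W) * \<dots> = 0\<^sub>m d d" by (simp add: eq square_zero)
  finally have "R * (Z - W) = 0\<^sub>m d d" by (rule zero_if_gram_zero[rotated]) simp
  then have "R * Z - R * W = 0\<^sub>m d d" by (simp add: mult_minus_distrib_mat[of _ d d _ d])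
  then show ?thesis by (rule eq_if_minus_eq_zero[rotated 2]) simp_all
qed

text \<open>Insert the resolution of the identity by \<open>B\<close> on the right of
  \<open>P y * S\<close>, or the one by \<open>P\<close> on the left of \<open>S * B y'\<close>: in
  both cases only \<open>P y * S * B y'\<close> survives.\<close>

lemma intertwine:
  assumes fin: "finite Y" "finite Y'" and S: "S \<in> square"
    and P: "\<And>z. z \<in> Y \<Longrightarrow> P z \<in> square" "sum_mat Y P = 1\<^sub>m d"
    and B: "\<And>z. z \<in> Y' \<Longrightarrow> B z \<in> square" "sum_mat Y' B = 1\<^sub>m d"
    and y: "y \<in> Y" "y' \<in> Y'"
    and zero_B: "\<And>z. z \<in> Y' \<Longrightarrow> z \<noteq> y' \<Longrightarrow> P y * S * B z = 0\<^sub>m d d"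
    and zero_P: "\<And>z. z \<in> Y \<Longrightarrow> z \<noteq> y \<Longrightarrow> P z * S * B y' = 0\<^sub>m d d"
  shows "P y * S * B y' = P y * S" "P y * S = S * B y'"
proof -
  note Py = P(1)[OF y(1)] and By = B(1)[OF y(2)]
  have "P y * S = P y * S * sum_mat Y' B" using Py S by (simp add: B(2) square_algebra)
  also have "\<dots> = sum_mat Y' (\<lambda>z. P y * S * B z)" using B(1) Py S by (intro mult_sum_mat) auto
  also have "\<dots> = P y * S * B y'"
    using fin y zero_B Py S By by (intro sum_mat_single) auto
  finally show 1: "P y * S * B y' = P y * S" by (rule sym)
  have "S * B y' = sum_mat Y P * (S * B y')" using By S by (simp add: P(2) square_algebra)
  also have "\<dots> = sum_mat Y (\<lambda>z. P z * (S * B y'))" using P(1) By S by (intro sum_mat_mult) auto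
  also have "\<dots> = sum_mat Y (\<lambda>z. P z * S * B y')"
    using P(1) By S by (intro sum_mat_cong) (simp add: assoc_mult_mat[of _ d d _ d _ d])
  also have "\<dots> = P y * S * B y'"
    using fin y zero_P Py S By by (intro sum_mat_single) auto
  finally show "P y * S = S * B y'" using 1 by simp
qed

lemma sum_trace_mult:
  assumes "\<And>y. y \<in> Y \<Longrightarrow> F y \<in> square" "\<And>y. y \<in> Y' \<Longrightarrow> F' y \<in> square"
  shows "(\<Sum>y\<in>Y. \<Sum>y'\<in>Y'. mat_trace (F y * F' y')) = mat_trace (sum_mat Y F * sum_mat Y' F')"
proof -
  have "mat_trace (F y * sum_mat Y' F') = (\<Sum>y'\<in>Y'. mat_trace (F y * F' y'))" if "y \<in> Y" for y
    using assms that by (simp add: mult_sum_mat trace_sum_mat)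
  then show ?thesis using assms(1) by (simp add: sum_mat_mult trace_sum_mat)
qed

section \<open>From strategies to matrices\<close>

lemma CSP_isomorphic_if_strategy:
  fixes G :: "'a pair_pre_digraph" and H :: "'b pair_pre_digraph"
  assumes fin: "finite (pverts G)" "finite (pverts H)"
  defines "V \<equiv> pverts G <+> pverts H"
  assumes strat: "quantum_strategy V d \<psi> P Q"
    and perfect: "\<And>xA xB yA yB. xA \<in> V \<Longrightarrow> xB \<in> V \<Longrightarrow> yA \<in> V \<Longrightarrow> yB \<in> V \<Longrightarrow>
      \<not> wins_iso_game G H xA xB yA yB \<Longrightarrow> correlation \<psi> P Q yA yB xA xB = 0"
  shows "cone_isomorphic CSP G H"
proof -
  have finV: "finite V" using fin by (simp add: V_def)
  define S where "S = mat_of_state \<psi>"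
  have S [simp]: "S \<in> square" by (simp add: S_def)
  have \<psi>: "\<psi> \<in> carrier_vec (d * d)" and norm: "\<psi> \<bullet>c \<psi> = 1"
    and P: "\<And>x y. x \<in> V \<Longrightarrow> y \<in> V \<Longrightarrow> psd d (P x y)" "\<And>x. x \<in> V \<Longrightarrow> sum_mat V (P x) = 1\<^sub>m d"
    and Q: "\<And>x y. x \<in> V \<Longrightarrow> y \<in> V \<Longrightarrow> psd d (Q x y)" "\<And>x. x \<in> V \<Longrightarrow> sum_mat V (Q x) = 1\<^sub>m d"
    using strat by (auto simp: quantum_strategy_def povm_iff)
  define B where "B = (\<lambda>x y. transpose_mat (Q x y))"
  have B: "psd d (B x y)" if "x \<in> V" "y \<in> V" for x y
    unfolding B_def by (intro psd_transpose Q that)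
  have sum_B: "sum_mat V (B x) = 1\<^sub>m d" if "x \<in> V" for x
  proof -
    have "sum_mat V (B x) = transpose_mat (sum_mat V (Q x))"
      unfolding B_def by (rule transpose_sum_mat[symmetric]) (rule psd_square[OF Q(1)[OF that]])
    then show ?thesis using Q(2)[OF that] by simp
  qed
  note Psq = psd_square[OF P(1)] and Bsq = psd_square[OF B]
  have corr: "correlation \<psi> P Q y y' x x' = mat_trace (mat_adjoint S * P x y * S * B x' y')"
    if "x \<in> V" "y \<in> V" "x' \<in> V" "y' \<in> V" for x y x' y'
    unfolding correlation_def S_def B_def
    using that by (intro correlation_eq_trace \<psi> psd_square P Q)
  have zero: "P x y * S * B x' y' = 0\<^sub>m d d"
    if "x \<in> V" "x' \<in> V" "y \<in> V" "y' \<in> V" "\<not> wins_iso_game G H x x' y y'" for x y x' y'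
    using perfect[OF that] corr[of x y x' y'] that by (intro psd_sandwich_eq_zero P B S) simp_all
  \<comment> \<open>The root \<open>R\<close> of \<open>K\<close> is the positive factor in the
    polar decomposition of \<open>S\<close>. Both have the same Gram matrix, so equations with left
    factor \<open>S\<close> transfer to \<open>R\<close>.\<close>
  define K where "K = mat_adjoint S * S"
  have "psd d K" using psd_gram[of "mat_adjoint S"] adjoint_adjoint[OF S] by (simp add: K_def)
  then obtain R P' X where R: "psd d R" and RR: "R * R = K" by (rule psd_sqrt_support)
  note [simp] = psd_square[OF R]
  have R_cancel: "R * Z = R * W" if "Z \<in> square" "W \<in> square" "S * Z = S * W" for Z W
  proof -
    have RRC: "R * (R * C) = mat_adjoint S * (S * C)" if "C \<in> square" for C
    proof -
      have "R * (R * C) = R * R * C" using that by (simp add: assoc_mult_mat[of R d d R d C d])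
      also have "\<dots> = mat_adjoint S * (S * C)" unfolding RR K_def using that by (simp add: square_algebra)
      finally show ?thesis .
    qed
    show ?thesis by (rule psd_cancel[OF R that(1,2)]) (simp add: RRC that)
  qed
  have trace_K: "mat_trace (R * R) = 1"
    using state_inner_product[OF \<psi>] norm by (simp add: RR K_def S_def)
  have VG: "Inl g \<in> V" if "g \<in> pverts G" for g using that unfolding V_def by (rule InlI)
  have VH: "Inr h \<in> V" if "h \<in> pverts H" for h using that unfolding V_def by (rule InrI)
  have lose: "\<not> wins_iso_game G H x x' y y'" if "isl x' = isl y'" for x x' y y'
    using that by (auto simp: wins_iso_game_def)
  \<comment> \<open>An answer of Bob in the same graph as his question loses against every answer of
    Alice, so Alice's resolution of the identity annihilates \<open>S * B x y\<close>.\<close>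
  have B_zero: "R * B x y = 0\<^sub>m d d" if xy: "x \<in> V" "y \<in> V" and "isl x = isl y" for x y
  proof -
    have "S * B x y = sum_mat V (P x) * (S * B x y)"
      using Bsq[OF xy] by (simp add: P(2) xy square_algebra)
    also have "\<dots> = sum_mat V (\<lambda>z. P x z * (S * B x y))"
      by (rule sum_mat_mult) (simp_all add: Psq Bsq xy)
    also have "\<dots> = sum_mat V (\<lambda>z. 0\<^sub>m d d)"
    proof (intro sum_mat_cong)
      fix z assume z: "z \<in> V"
      have "P x z * S * B x y = 0\<^sub>m d d" using xy z lose[OF \<open>isl x = isl y\<close>] by (intro zero)
      then show "P x z * (S * B x y) = 0\<^sub>m d d"
        using Psq[OF xy(1) z] Bsq[OF xy] by (simp add: assoc_mult_mat[of _ d d _ d _ d])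
    qed
    also have "\<dots> = 0\<^sub>m d d" by (intro square_eqI) (auto simp: index_sum_mat)
    also have "\<dots> = S * 0\<^sub>m d d" by (simp add: square_zero)
    finally have "R * B x y = R * 0\<^sub>m d d"
      by (rule R_cancel[rotated 2]) (simp_all add: Bsq xy)
    then show ?thesis by (simp add: square_zero)
  qed
  have PB: "P (Inl g) (Inr h) * S * B (Inl g) (Inr h) = P (Inl g) (Inr h) * S"
      "P (Inl g) (Inr h) * S = S * B (Inl g) (Inr h)"
      "P (Inl g) (Inr h) * S = S * B (Inr h) (Inl g)"
    if g: "g \<in> pverts G" and h: "h \<in> pverts H" for g h
  proof -
    note in_V = VG[OF g] VH[OF h]
    \<comment> \<open>If both players get \<open>g\<close>, only equal answers win. If Alice gets
      \<open>g\<close> and Bob gets \<open>h\<close>, Alice answers \<open>h\<close> exactly when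
      Bob answers \<open>g\<close>, in any winning round.\<close>
    have 1: "\<not> wins_iso_game G H (Inl g) (Inl g) (Inr h) z"
        "\<not> wins_iso_game G H (Inl g) (Inl g) z (Inr h)" if "z \<noteq> Inr h" for z
      using that by (cases z; auto simp: wins_iso_game_def G_vertex_def H_vertex_def rel_def split: if_splits)+
    have 2: "\<not> wins_iso_game G H (Inl g) (Inr h) (Inr h) z" if "z \<noteq> Inl g" for z
      using that by (cases z; auto simp: wins_iso_game_def G_vertex_def H_vertex_def rel_def split: if_splits)
    have 3: "\<not> wins_iso_game G H (Inl g) (Inr h) z (Inl g)" if "z \<noteq> Inr h" for z
      using that by (cases z; auto simp: wins_iso_game_def G_vertex_def H_vertex_def rel_def split: if_splits)
    show "P (Inl g) (Inr h) * S * B (Inl g) (Inr h) = P (Inl g) (Inr h) * S"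
      "P (Inl g) (Inr h) * S = S * B (Inl g) (Inr h)"
      by (rule intertwine[OF finV finV S Psq P(2) Bsq sum_B]; use in_V in \<open>auto intro!: zero 1\<close>)+
    show "P (Inl g) (Inr h) * S = S * B (Inr h) (Inl g)"
      by (rule intertwine[OF finV finV S Psq P(2) Bsq sum_B]; use in_V in \<open>auto intro!: zero 2 3\<close>)
  qed
  define \<rho> where "\<rho> = (\<lambda>(g, h). R * B (Inl g) (Inr h))"
  have \<rho>: "psd d (\<rho> (g, h))" "\<rho> (g, h) = R * B (Inr h) (Inl g)"
    and trace_\<rho>: "\<And>B'. B' \<in> square \<Longrightarrow> mat_trace (\<rho> (g, h) * (R * B')) =
      mat_trace (mat_adjoint S * P (Inl g) (Inr h) * S * B')"
    if g: "g \<in> pverts G" and h: "h \<in> pverts H" for g h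
  proof -
    note in_V = VG[OF g] VH[OF h]
    let ?P = "P (Inl g) (Inr h)" and ?B = "B (Inl g) (Inr h)"
    note psdB = B[OF in_V]
    note [simp] = Psq[OF in_V] Bsq[OF in_V] Bsq[OF in_V(2,1)]
    \<comment> \<open>The right-hand side is Hermitian, so \<open>?B\<close> commutes with
      \<open>K\<close>, and therefore with \<open>R\<close>.\<close>
    have KB: "K * ?B = mat_adjoint S * (?P * S)" by (simp add: K_def PB(2)[OF g h] square_algebra)
    have "?B * K = mat_adjoint (K * ?B)"
      by (simp add: adjoint_simps K_def psd_adjoint[OF psdB])
    also have "\<dots> = mat_adjoint S * (?P * S)"
      unfolding KB by (simp add: adjoint_simps psd_adjoint[OF P(1)[OF in_V]] square_algebra)
    finally have "R * (R * ?B) = ?B * (R * R)"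
      using KB RR assoc_mult_mat[of R d d R d ?B d] by simp
    then have comm: "R * ?B = ?B * R"
      by (intro psd_commute_if_square_commutes R psd_adjoint[OF psdB]) auto
    \<comment> \<open>Idempotence of \<open>?B\<close> is obtained after multiplication by
      \<open>S\<close>, and from there by \<open>R\<close>.\<close>
    have "S * (?B * ?B) = ?P * S * ?B"
      using assoc_mult_mat[of S d d ?B d ?B d] by (simp add: PB(2)[OF g h])
    also have "\<dots> = S * ?B" using PB[OF g h] by simp
    finally have idem: "R * (?B * ?B) = R * ?B" by (rule R_cancel[rotated 2]) simp_all
    have "\<rho> (g, h) = ?B * R * mat_adjoint ?B"
      using idem assoc_mult_mat[of R d d ?B d ?B d]
      by (simp add: \<rho>_def comm psd_adjoint[OF psdB])
    then show "psd d (\<rho> (g, h))" using psd_congruence[OF R, of ?B] by simp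
    \<comment> \<open>Both operators of Bob intertwine with the same operator of Alice. Hence
      columns can be summed with Bob's measurement for the question \<open>h\<close>.\<close>
    show "\<rho> (g, h) = R * B (Inr h) (Inl g)"
      unfolding \<rho>_def prod.case by (rule R_cancel) (use PB[OF g h] in auto)
    fix B' :: "complex mat" assume [simp]: "B' \<in> square"
    \<comment> \<open>Commuting \<open>?B\<close> past \<open>R\<close> brings the two roots
      together to \<open>K\<close>; the trace is then a correlation of the strategy, which yields
      the zero entries of \<open>M\<close>.\<close>
    have "\<rho> (g, h) * (R * B') = ?B * ((R * R) * B')"
      by (simp add: \<rho>_def comm square_algebra)
    also have "\<dots> = R * R * ?B * B'"
      using KB \<open>R * (R * ?B) = ?B * (R * R)\<close> by (simp add: square_algebra)
    also have "\<dots> = mat_adjoint S * ?P * S * B'"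
      unfolding RR KB by (simp add: square_algebra)
    finally show "mat_trace (\<rho> (g, h) * (R * B')) = mat_trace (mat_adjoint S * ?P * S * B')" by simp
  qed
  \<comment> \<open>Together with \<open>B_zero\<close>, which removes the answers in the wrong
    graph, this makes \<open>R\<close> the common row and column sum.\<close>
  have sum_R: "sum_mat V (\<lambda>y. R * B x y) = R" if "x \<in> V" for x
  proof -
    have "sum_mat V (\<lambda>y. R * B x y) = R * sum_mat V (B x)"
      using Bsq[OF that] by (intro mult_sum_mat[symmetric]) auto
    then show ?thesis by (simp add: sum_B that square_algebra)
  qed
  have row: "sum_mat (pverts H) (\<lambda>h. \<rho> (g, h)) = R" if g: "g \<in> pverts G" for g
  proof -
    have "sum_mat V (\<lambda>y. R * B (Inl g) y) = sum_mat (pverts H) (\<lambda>h. \<rho> (g, h))"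
    proof (rule square_eqI)
      fix i j assume ij: "i < d" "j < d"
      have "(R * B (Inl g) (Inl g')) $$ (i, j) = 0" if "g' \<in> pverts G" for g'
        using B_zero[OF VG[OF g] VG[OF that]] ij by simp
      then show "sum_mat V (\<lambda>y. R * B (Inl g) y) $$ (i, j) = sum_mat (pverts H) (\<lambda>h. \<rho> (g, h)) $$ (i, j)"
        using ij fin by (simp add: index_sum_mat V_def sum.Plus \<rho>_def)
    qed auto
    then show ?thesis using sum_R[OF VG[OF g]] by simp
  qed
  have col: "sum_mat (pverts G) (\<lambda>g. \<rho> (g, h)) = R" if h: "h \<in> pverts H" for h
  proof -
    have "sum_mat V (\<lambda>y. R * B (Inr h) y) = sum_mat (pverts G) (\<lambda>g. \<rho> (g, h))"
    proof (rule square_eqI)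
      fix i j assume ij: "i < d" "j < d"
      have "(R * B (Inr h) (Inr h')) $$ (i, j) = 0" if "h' \<in> pverts H" for h'
        using B_zero[OF VH[OF h] VH[OF that]] ij by simp
      moreover have "\<rho> (g, h) $$ (i, j) = (R * B (Inr h) (Inl g)) $$ (i, j)" if "g \<in> pverts G" for g
        using \<rho>(2)[OF that h] by simp
      ultimately show "sum_mat V (\<lambda>y. R * B (Inr h) y) $$ (i, j) = sum_mat (pverts G) (\<lambda>g. \<rho> (g, h)) $$ (i, j)"
        using ij fin by (simp add: index_sum_mat V_def sum.Plus)
    qed auto
    then show ?thesis using sum_R[OF VH[OF h]] by simp
  qed
  define M where "M = (\<lambda>i j. Re (mat_trace (\<rho> i * \<rho> j)))"
  have psd_\<rho>: "psd d (\<rho> i)" if "i \<in> pverts G \<times> pverts H" for i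
    using that \<rho>(1) by (cases i) auto
  have M_trace: "complex_of_real (M i j) = mat_trace (mat_adjoint (\<rho> i) * \<rho> j)"
    if "i \<in> pverts G \<times> pverts H" "j \<in> pverts G \<times> pverts H" for i j
    unfolding M_def psd_adjoint[OF psd_\<rho>[OF that(1)]]
    by (rule trace_mult_psd_real[OF psd_\<rho> psd_\<rho>, OF that])
  have M_CSP: "M \<in> CSP (pverts G \<times> pverts H)"
    unfolding CSP_def mem_Collect_eq
    by (intro exI[of _ d] exI[of _ \<rho>] conjI ballI psd_\<rho> M_trace)
  have \<rho>_sq: "\<rho> (g, h) \<in> square" if "g \<in> pverts G" "h \<in> pverts H" for g h
    using psd_square[OF \<rho>(1)[OF that]] .
  have row_sum: "(\<Sum>h\<in>pverts H. \<Sum>h'\<in>pverts H. M (g, h) (g', h')) = 1"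
    if g: "g \<in> pverts G" "g' \<in> pverts G" for g g'
  proof -
    have "(\<Sum>h\<in>pverts H. \<Sum>h'\<in>pverts H. mat_trace (\<rho> (g, h) * \<rho> (g', h'))) =
        mat_trace (sum_mat (pverts H) (\<lambda>h. \<rho> (g, h)) * sum_mat (pverts H) (\<lambda>h. \<rho> (g', h)))"
      by (intro sum_trace_mult \<rho>_sq g)
    from arg_cong[OF this, of Re] show ?thesis by (simp add: M_def trace_K row g)
  qed
  have col_sum: "(\<Sum>g\<in>pverts G. \<Sum>g'\<in>pverts G. M (g, h) (g', h')) = 1"
    if h: "h \<in> pverts H" "h' \<in> pverts H" for h h'
  proof -
    have "(\<Sum>g\<in>pverts G. \<Sum>g'\<in>pverts G. mat_trace (\<rho> (g, h) * \<rho> (g', h'))) =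
        mat_trace (sum_mat (pverts G) (\<lambda>g. \<rho> (g, h)) * sum_mat (pverts G) (\<lambda>g. \<rho> (g, h')))"
      by (intro sum_trace_mult \<rho>_sq h)
    from arg_cong[OF this, of Re] show ?thesis by (simp add: M_def trace_K col h)
  qed
  have M_zero: "M (g, h) (g', h') = 0"
    if g: "g \<in> pverts G" "g' \<in> pverts G" and h: "h \<in> pverts H" "h' \<in> pverts H"
      and "rel G g g' \<noteq> rel H h h'" for g g' h h'
  proof -
    have "\<not> wins_iso_game G H (Inl g) (Inl g') (Inr h) (Inr h')"
      using that by (simp add: wins_iso_game_def G_vertex_def H_vertex_def)
    then have "mat_trace (mat_adjoint S * P (Inl g) (Inr h) * S * B (Inl g') (Inr h')) = 0"
      using perfect[OF VG[OF g(1)] VG[OF g(2)] VH[OF h(1)] VH[OF h(2)]]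
        corr[OF VG[OF g(1)] VH[OF h(1)] VG[OF g(2)] VH[OF h(2)]] by simp
    then have "mat_trace (\<rho> (g, h) * (R * B (Inl g') (Inr h'))) = 0"
      using trace_\<rho>[OF g(1) h(1) Bsq[OF VG[OF g(2)] VH[OF h(2)]]] by simp
    then show ?thesis by (simp add: M_def \<rho>_def)
  qed
  show ?thesis unfolding cone_isomorphic_def
    by (rule bexI[OF _ M_CSP], intro conjI ballI impI)
      (rule row_sum col_sum M_zero, assumption+)+
qed

section \<open>From matrices to strategies\<close>

text \<open>
  The outcomes \<open>y \<noteq> x\<close> are measured by the support projections of the \<open>F y\<close>; the remaining projection
  annihilates \<open>S\<close>, so it can be given to the outcome \<open>x\<close> with \<open>F x = 0\<close>.
\<close>

lemma measurement_of_decomposition: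
  assumes fin: "finite Y" and x: "x \<in> Y" and psd: "\<And>y. y \<in> Y \<Longrightarrow> psd d (F y)"
    and orth: "\<And>y y'. y \<in> Y \<Longrightarrow> y' \<in> Y \<Longrightarrow> y \<noteq> y' \<Longrightarrow> F y * F y' = 0\<^sub>m d d"
    and Fx: "F x = 0\<^sub>m d d" and sum: "sum_mat Y F = S"
  shows "\<exists>P. povm d Y P \<and> (\<forall>y\<in>Y. P y * S = F y)"
proof -
  note F = psd_square[OF psd]
  have "\<exists>N X. N \<in> square \<and> mat_adjoint N = N \<and> N * N = N \<and> F y * N = F y \<and> X \<in> square \<and> N = F y * X"
    if "y \<in> Y" for y
  proof -
    note Fy = psd[OF that]
    obtain R N X where "N \<in> square" "mat_adjoint N = N" "N * N = N" "F y * N = F y"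
      "X \<in> square" "N = F y * X"
      by (rule psd_sqrt_support[OF Fy])
    then show ?thesis by blast
  qed
  then obtain N where "\<And>y. y \<in> Y \<Longrightarrow> \<exists>X. N y \<in> square \<and> mat_adjoint (N y) = N y \<and> N y * N y = N y \<and>
      F y * N y = F y \<and> X \<in> square \<and> N y = F y * X"
    by metis
  then obtain X where NX: "\<And>y. y \<in> Y \<Longrightarrow> N y \<in> square \<and> mat_adjoint (N y) = N y \<and> N y * N y = N y \<and>
      F y * N y = F y \<and> X y \<in> square \<and> N y = F y * X y"
    by metis
  have N: "N y \<in> square" and N_adj: "mat_adjoint (N y) = N y" and N_idem: "N y * N y = N y"
    and FN: "F y * N y = F y" and X: "X y \<in> square" and N_eq: "N y = F y * X y" if "y \<in> Y" for y
    using NX[OF that] by blast+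
  \<comment> \<open>The factorisation of the support projection through \<open>F y\<close> carries
    orthogonality over from the \<open>F\<close> to their supports.\<close>
  have FN0: "F y' * N y = 0\<^sub>m d d" if y: "y \<in> Y" "y' \<in> Y" "y' \<noteq> y" for y y'
    unfolding N_eq[OF y(1)]
    using mult_assoc_eq[OF orth[OF y(2,1,3)] F[OF y(2)] F[OF y(1)] X[OF y(1)]] X[OF y(1)]
    by (simp add: square_zero)
  have NF0: "N y * F y' = 0\<^sub>m d d" if y: "y \<in> Y" "y' \<in> Y" "y' \<noteq> y" for y y'
    using arg_cong[OF FN0[OF y], of mat_adjoint] N[OF y(1)] F[OF y(2)]
    by (simp add: adjoint_mult adjoint_zero N_adj[OF y(1)] psd_adjoint[OF psd[OF y(2)]])
  have NF: "N y * F y = F y" if y: "y \<in> Y" for y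
    using arg_cong[OF FN[OF y], of mat_adjoint] N[OF y(1)] F[OF y]
    by (simp add: adjoint_mult N_adj[OF y(1)] psd_adjoint[OF psd[OF y]])
  have NN0: "N y * N y' = 0\<^sub>m d d" if y: "y \<in> Y" "y' \<in> Y" "y' \<noteq> y" for y y'
    unfolding N_eq[OF y(2)]
    using mult_assoc_eq[OF NF0[OF y] N[OF y(1)] F[OF y(2)] X[OF y(2)]] X[OF y(2)]
    by (simp add: square_zero)
  have Nx: "N x = 0\<^sub>m d d" using N_eq[OF x] X[OF x] by (simp add: Fx square_zero)
  define E where "E = sum_mat Y N"
  have E [simp]: "E \<in> square" by (simp add: E_def)
  have NE: "N y * E = N y" if y: "y \<in> Y" for y
  proof -
    have "N y * E = sum_mat Y (\<lambda>y'. N y * N y')"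
      unfolding E_def by (rule mult_sum_mat) (simp_all add: N y)
    also have "\<dots> = N y * N y" by (rule sum_mat_single[OF fin y]) (simp_all add: N y NN0)
    finally show ?thesis by (simp add: N_idem y)
  qed
  have E_idem: "E * E = E"
  proof -
    have "E * E = sum_mat Y (\<lambda>y. N y * E)"
      by (subst (1) E_def) (rule sum_mat_mult, simp_all add: N)
    also have "\<dots> = E" unfolding E_def by (rule sum_mat_cong) (rule NE[unfolded E_def])
    finally show ?thesis .
  qed
  have E_adj: "mat_adjoint E = E"
    unfolding E_def by (subst adjoint_sum_mat) (auto intro: sum_mat_cong simp: N N_adj)
  have S [simp]: "S \<in> square" using sum by auto
  have NS: "N y * S = F y" if y: "y \<in> Y" for y
  proof -
    have "N y * S = sum_mat Y (\<lambda>y'. N y * F y')"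
      unfolding sum[symmetric] by (rule mult_sum_mat) (simp_all add: F N y)
    also have "\<dots> = N y * F y" by (rule sum_mat_single[OF fin y]) (simp_all add: F N y NF0)
    finally show ?thesis by (simp add: NF y)
  qed
  have ES: "E * S = S"
  proof -
    have "E * S = sum_mat Y (\<lambda>y. N y * S)"
      unfolding E_def by (rule sum_mat_mult) (simp_all add: N)
    also have "\<dots> = S" unfolding sum[symmetric] by (rule sum_mat_cong) (rule NS[unfolded sum[symmetric]])
    finally show ?thesis .
  qed
  define P where "P = N(x := 1\<^sub>m d - E)"
  have P_x: "P x = 1\<^sub>m d - E" and P_y: "y \<noteq> x \<Longrightarrow> P y = N y" for y by (simp_all add: P_def)
  have "psd d (P y)" if "y \<in> Y" for y
  proof (cases "y = x")
    case True
    have "psd d (1\<^sub>m d - E)"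
      by (rule psd_projection) (simp_all add: adjoint_simps E_adj square_algebra square_zero E_idem)
    then show ?thesis by (simp add: True P_x)
  next
    case False
    then show ?thesis by (simp add: P_y psd_projection N N_adj N_idem that)
  qed
  moreover have "sum_mat Y P = 1\<^sub>m d"
  proof (rule square_eqI)
    fix i j assume ij: "i < d" "j < d"
    have "sum_mat Y P $$ (i, j) = P x $$ (i, j) + (\<Sum>y\<in>Y - {x}. P y $$ (i, j))"
      using ij by (simp add: index_sum_mat sum.remove[OF fin x])
    also have "(\<Sum>y\<in>Y - {x}. P y $$ (i, j)) = (\<Sum>y\<in>Y - {x}. N y $$ (i, j))"
      by (rule sum.cong) (simp_all add: P_y)
    also have "\<dots> = E $$ (i, j)"
      using ij Nx by (simp add: E_def index_sum_mat sum.remove[OF fin x])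
    finally show "sum_mat Y P $$ (i, j) = 1\<^sub>m d $$ (i, j)"
      using ij carrier_matD[OF E] by (simp add: P_x)
  qed simp_all
  moreover have "P y * S = F y" if "y \<in> Y" for y
  proof (cases "y = x")
    case True
    then show ?thesis
      by (simp add: P_x Fx minus_mult_distrib_mat[of _ d d _ _ d] left_mult_one_mat[of _ d d] ES square_zero)
  next
    case False
    then show ?thesis by (simp add: P_y NS that)
  qed
  ultimately show ?thesis unfolding povm_iff by blast
qed

text \<open>The counterpart of \<open>eq_if_unit_products\<close> for the trace inner product: the
  squared norm of \<open>A - B\<close> is \<open>1 - 1 - (1 - 1)\<close>.\<close>

lemma eq_if_unit_traces:
  assumes [simp]: "A \<in> square" "B \<in> square" and adj: "mat_adjoint A = A" "mat_adjoint B = B"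
    and tr: "mat_trace (A * A) = 1" "mat_trace (A * B) = 1" "mat_trace (B * B) = 1"
  shows "A = B"
proof (rule eq_if_minus_eq_zero)
  have "mat_trace (mat_adjoint (A - B) * (A - B)) =
      mat_trace (A * A) - mat_trace (B * A) - (mat_trace (A * B) - mat_trace (B * B))"
    by (simp add: adjoint_minus adj trace_minus minus_mult_distrib_mat[of _ d d _ _ d]
        mult_minus_distrib_mat[of _ d d _ d])
  also have "\<dots> = 0" using tr trace_comm[of B A] by simp
  finally show "A - B = 0\<^sub>m d d" by (rule zero_if_trace_zero[rotated]) simp
qed simp_all

lemma quantum_isomorphic_if_gram:
  fixes G :: "'a pair_pre_digraph" and H :: "'b pair_pre_digraph"
  assumes fin: "finite (pverts G)" "finite (pverts H)" and ne: "pverts G \<noteq> {}"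
    and \<rho>: "\<And>g h. g \<in> pverts G \<Longrightarrow> h \<in> pverts H \<Longrightarrow> psd d (\<rho> (g, h))"
    and row: "\<And>g g'. g \<in> pverts G \<Longrightarrow> g' \<in> pverts G \<Longrightarrow>
      (\<Sum>h\<in>pverts H. \<Sum>h'\<in>pverts H. mat_trace (\<rho> (g, h) * \<rho> (g', h'))) = 1"
    and col: "\<And>h h'. h \<in> pverts H \<Longrightarrow> h' \<in> pverts H \<Longrightarrow>
      (\<Sum>g\<in>pverts G. \<Sum>g'\<in>pverts G. mat_trace (\<rho> (g, h) * \<rho> (g', h'))) = 1"
    and zero: "\<And>g g' h h'. g \<in> pverts G \<Longrightarrow> g' \<in> pverts G \<Longrightarrow> h \<in> pverts H \<Longrightarrow> h' \<in> pverts H \<Longrightarrow>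
      rel G g g' \<noteq> rel H h h' \<Longrightarrow> mat_trace (\<rho> (g, h) * \<rho> (g', h')) = 0"
  shows "quantum_isomorphic G H"
proof -
  let ?G = "pverts G" and ?H = "pverts H"
  note \<rho>_sq = psd_square[OF \<rho>] and \<rho>_adj = psd_adjoint[OF \<rho>]
  obtain g0 where g0: "g0 \<in> ?G" using ne by blast
  have "?H \<noteq> {}" using row[OF g0 g0] by auto
  then obtain h0 where h0: "h0 \<in> ?H" by blast
  define A where "A = (\<lambda>g. sum_mat ?H (\<lambda>h. \<rho> (g, h)))"
  define B where "B = (\<lambda>h. sum_mat ?G (\<lambda>g. \<rho> (g, h)))"
  have A_sq [simp]: "A g \<in> square" and B_sq [simp]: "B h \<in> square" for g h
    by (simp_all add: A_def B_def)
  have A_adj: "mat_adjoint (A g) = A g" if g: "g \<in> ?G" for g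
    unfolding A_def
    by (subst adjoint_sum_mat) (auto intro!: sum_mat_cong simp: \<rho>_sq \<rho>_adj g)
  have B_adj: "mat_adjoint (B h) = B h" if h: "h \<in> ?H" for h
    unfolding B_def
    by (subst adjoint_sum_mat) (auto intro!: sum_mat_cong simp: \<rho>_sq \<rho>_adj h)
  have A_tr: "mat_trace (A g * A g') = 1" if g: "g \<in> ?G" "g' \<in> ?G" for g g'
    unfolding A_def row[OF g, symmetric] by (rule sum_trace_mult[symmetric]) (simp_all add: \<rho>_sq g)
  have B_tr: "mat_trace (B h * B h') = 1" if h: "h \<in> ?H" "h' \<in> ?H" for h h'
    unfolding B_def col[OF h, symmetric] by (rule sum_trace_mult[symmetric]) (simp_all add: \<rho>_sq h)
  define S where "S = A g0"
  have S [simp]: "S \<in> square" by (simp add: S_def)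
  have S_adj: "mat_adjoint S = S" by (simp add: S_def A_adj g0)
  have S_tr: "mat_trace (S * S) = 1" by (simp add: S_def A_tr g0)
  have A_S: "A g = S" if g: "g \<in> ?G" for g
    unfolding S_def by (rule eq_if_unit_traces) (simp_all add: A_adj A_tr g g0)
  have B_h0: "B h = B h0" if h: "h \<in> ?H" for h
    by (rule eq_if_unit_traces) (simp_all add: B_adj B_tr h h0)
  \<comment> \<open>Summing all \<open>\<rho> (g, h)\<close> by rows and by columns compares
    multiples of the two common sums. Both have norm 1, so the multiples agree and the sums
    coincide.\<close>
  have double: "of_nat (card ?G) * S $$ (i, j) = of_nat (card ?H) * B h0 $$ (i, j)" if ij: "i < d" "j < d" for i j
  proof -
    have "(\<Sum>g\<in>?G. A g $$ (i, j)) = (\<Sum>h\<in>?H. B h $$ (i, j))"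
      unfolding A_def B_def index_sum_mat[OF ij] by (rule sum.swap)
    then show ?thesis using A_S B_h0 by simp
  qed
  have smult_eq: "of_nat (card ?G) \<cdot>\<^sub>m S = of_nat (card ?H) \<cdot>\<^sub>m B h0"
    by (rule square_eqI) (use double carrier_matD[OF S] carrier_matD[OF B_sq] in simp_all)
  have "of_nat (card ?G) * of_nat (card ?G) * mat_trace (S * S) =
      of_nat (card ?H) * of_nat (card ?H) * mat_trace (B h0 * B h0)"
  proof -
    have "mat_trace ((of_nat (card ?G) \<cdot>\<^sub>m S) * (of_nat (card ?G) \<cdot>\<^sub>m S)) =
        mat_trace ((of_nat (card ?H) \<cdot>\<^sub>m B h0) * (of_nat (card ?H) \<cdot>\<^sub>m B h0))"
      unfolding smult_eq ..
    then show ?thesis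
      by (simp add: mult_smult_assoc_mat[of _ d d _ d] mult_smult_distrib[of _ d d _ d] trace_smult mult.assoc)
  qed
  then have "(of_nat (card ?G * card ?G) :: complex) = of_nat (card ?H * card ?H)"
    by (simp add: S_tr B_tr h0)
  then have card: "card ?G = card ?H"
    by (metis mult_eq_self_implies_10 nat_mult_eq_cancel_disj of_nat_eq_iff power2_eq_iff_nonneg power2_eq_square zero_le)
  have "card ?H \<noteq> 0" using fin \<open>?H \<noteq> {}\<close> by simp
  then have "S = B h0"
    using double card by (intro square_eqI) simp_all
  then have B_S: "B h = S" if "h \<in> ?H" for h using B_h0[OF that] by simp
  define V where "V = ?G <+> ?H"
  have finV: "finite V" using fin by (simp add: V_def)
  \<comment> \<open>The question \<open>g\<close> with answer \<open>h\<close> and the question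
    \<open>h\<close> with answer \<open>g\<close> share one matrix; answers in the wrong graph get
    0. In particular \<open>F x x\<close> is zero, as \<open>measurement_of_decomposition\<close>
    requires.\<close>
  define F where "F = (\<lambda>x y. case (x, y) of (Inl g, Inr h) \<Rightarrow> \<rho> (g, h) | (Inr h, Inl g) \<Rightarrow> \<rho> (g, h)
    | _ \<Rightarrow> 0\<^sub>m d d)"
  have F_simps [simp]: "F (Inl g) (Inl g') = 0\<^sub>m d d" "F (Inr h) (Inr h') = 0\<^sub>m d d"
      "F (Inl g) (Inr h) = \<rho> (g, h)" "F (Inr h) (Inl g) = \<rho> (g, h)" for g g' h h'
    by (simp_all add: F_def)
  have psd_zero: "psd d (0\<^sub>m d d)"
    using psd_gram[of "0\<^sub>m d d"] by (simp add: adjoint_zero square_zero)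
  have F_psd: "psd d (F x y)" if "x \<in> V" "y \<in> V" for x y
    using that by (cases x; cases y) (auto simp: V_def psd_zero \<rho>)
  note F_sq = psd_square[OF F_psd]
  have F_sum: "sum_mat V (F x) = S" if "x \<in> V" for x
  proof (cases x)
    case (Inl g)
    then have g: "g \<in> ?G" using that by (auto simp: V_def)
    have "sum_mat V (F x) = A g"
      unfolding A_def using fin
      by (intro square_eqI) (simp_all add: index_sum_mat V_def sum.Plus Inl)
    then show ?thesis by (simp add: A_S g)
  next
    case (Inr h)
    then have h: "h \<in> ?H" using that by (auto simp: V_def)
    have "sum_mat V (F x) = B h"
      unfolding B_def using fin
      by (intro square_eqI) (simp_all add: index_sum_mat V_def sum.Plus Inr)
    then show ?thesis by (simp add: B_S h)
  qed
  \<comment> \<open>Two different answers to one question relate an equal pair to a distinct pair,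
    so the corresponding entry is zero.\<close>
  have F_orth: "F x y * F x y' = 0\<^sub>m d d" if "x \<in> V" "y \<in> V" "y' \<in> V" "y \<noteq> y'" for x y y'
  proof (rule psd_mult_eq_zero)
    show "mat_trace (F x y * F x y') = 0"
      using that trace_zero F_sq
      by (cases x; cases y; cases y') (auto simp: V_def square_zero \<rho>_sq intro!: zero)
  qed (intro F_psd that)+
  have "\<exists>P. povm d V P \<and> (\<forall>y\<in>V. P y * S = F x y)" if x: "x \<in> V" for x
  proof (rule measurement_of_decomposition[OF finV x])
    show "F x x = 0\<^sub>m d d" by (cases x) simp_all
  qed (simp_all add: F_psd F_orth F_sum x)
  then obtain P where P: "\<And>x. x \<in> V \<Longrightarrow> povm d V (P x)"
    and PS: "\<And>x y. x \<in> V \<Longrightarrow> y \<in> V \<Longrightarrow> P x y * S = F x y"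
    by metis
  have P_psd: "psd d (P x y)" if "x \<in> V" "y \<in> V" for x y using P[OF that(1)] that(2) by (simp add: povm_iff)
  note P_sq = psd_square[OF P_psd]
  \<comment> \<open>This transpose cancels the one in \<open>correlation_eq_trace\<close>, so both
    players effectively measure \<open>S\<close> with the same operators.\<close>
  define Q where "Q = (\<lambda>x y. transpose_mat (P x y))"
  define \<psi> where "\<psi> = state_of_mat S"
  have \<psi>: "\<psi> \<in> carrier_vec (d * d)" by (simp add: \<psi>_def state_of_mat_def)
  have \<psi>_S: "mat_of_state \<psi> = S" by (simp add: \<psi>_def mat_of_state_of_mat)
  have "povm d V (Q x)" if x: "x \<in> V" for x
  proof -
    have "sum_mat V (Q x) = transpose_mat (sum_mat V (P x))"
      unfolding Q_def by (rule transpose_sum_mat[symmetric]) (rule P_sq[OF x])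
    then show ?thesis
      using P[OF x] by (simp add: povm_iff Q_def psd_transpose)
  qed
  moreover have "\<psi> \<bullet>c \<psi> = 1"
    by (simp add: state_inner_product[OF \<psi>] \<psi>_S S_adj S_tr)
  ultimately have strat: "quantum_strategy V d \<psi> P Q"
    using \<psi> P by (simp add: quantum_strategy_def)
  have corr: "correlation \<psi> P Q y y' x x' = mat_trace (F x y * F x' y')"
    if x: "x \<in> V" "x' \<in> V" and y: "y \<in> V" "y' \<in> V" for x x' y y'
  proof -
    note [simp] = P_sq[OF x(1) y(1)] P_sq[OF x(2) y(2)]
    have "correlation \<psi> P Q y y' x x' = mat_trace (S * P x y * S * P x' y')"
      unfolding correlation_def Q_def
      by (subst correlation_eq_trace[OF \<psi>]) (simp_all add: \<psi>_S S_adj)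
    also have "S * P x y * S * P x' y' = S * (P x y * S * P x' y')" by (simp add: square_algebra)
    \<comment> \<open>The cyclic shift pairs each measurement operator with its own copy of
      \<open>S\<close>.\<close>
    also have "mat_trace \<dots> = mat_trace (P x y * S * P x' y' * S)" by (rule trace_comm) simp_all
    also have "P x y * S * P x' y' * S = (P x y * S) * (P x' y' * S)" by (simp add: square_algebra)
    finally show ?thesis by (simp add: PS x y)
  qed
  have "correlation \<psi> P Q yA yB xA xB = 0"
    if x: "xA \<in> V" "xB \<in> V" and y: "yA \<in> V" "yB \<in> V" and lose: "\<not> wins_iso_game G H xA xB yA yB"
    for xA xB yA yB
  proof -
    \<comment> \<open>A losing round either has an answer in the wrong graph, where \<open>F\<close>
      is 0, or violates the equality of relations, where the hypothesis on zero entries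
      applies.\<close>
    have "mat_trace (F xA yA * F xB yB) = 0"
      using x y lose trace_zero F_sq[OF x(1) y(1)] F_sq[OF x(2) y(2)]
      by (cases xA; cases xB; cases yA; cases yB)
        (auto simp: V_def square_zero wins_iso_game_def G_vertex_def H_vertex_def intro!: zero)
    then show ?thesis by (simp add: corr x y)
  qed
  then show ?thesis
    unfolding quantum_isomorphic_def Let_def V_def[symmetric] using strat by blast
qed

end

section \<open>Empty graphs and the combination of the implications\<close>

lemma quantum_isomorphic_if_empty:
  fixes G :: "'a pair_pre_digraph" and H :: "'b pair_pre_digraph"
  assumes "pverts G = {}" "pverts H = {}"
  shows "quantum_isomorphic G H"
proof -
  have empty: "pverts G <+> pverts H = {}" using assms by (auto elim: PlusE)
  \<comment> \<open>Without questions the measurements are unconstrained, but a unit vector must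
    exist, hence dimension 1.\<close>
  have "quantum_strategy {} 1 (vec 1 (\<lambda>_. 1)) P Q" for P Q :: "'a + 'b \<Rightarrow> 'a + 'b \<Rightarrow> complex mat"
    by (simp add: quantum_strategy_def scalar_prod_def)
  then show ?thesis unfolding quantum_isomorphic_def Let_def empty by blast
qed

lemma quantum_isomorphic_if_CSP_isomorphic:
  assumes fin: "finite (pverts G)" "finite (pverts H)" and iso: "cone_isomorphic CSP G H"
  shows "quantum_isomorphic G H"
proof -
  obtain M where M: "M \<in> CSP (pverts G \<times> pverts H)"
    and row: "\<And>g g'. g \<in> pverts G \<Longrightarrow> g' \<in> pverts G \<Longrightarrow>
      (\<Sum>h\<in>pverts H. \<Sum>h'\<in>pverts H. M (g, h) (g', h')) = 1"
    and col: "\<And>h h'. h \<in> pverts H \<Longrightarrow> h' \<in> pverts H \<Longrightarrow>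
      (\<Sum>g\<in>pverts G. \<Sum>g'\<in>pverts G. M (g, h) (g', h')) = 1"
    and zero: "\<And>g g' h h'. g \<in> pverts G \<Longrightarrow> g' \<in> pverts G \<Longrightarrow> h \<in> pverts H \<Longrightarrow> h' \<in> pverts H \<Longrightarrow>
      rel G g g' \<noteq> rel H h h' \<Longrightarrow> M (g, h) (g', h') = 0"
    using iso unfolding cone_isomorphic_def by blast
  show ?thesis
  proof (cases "pverts G = {}")
    case True
    then have "pverts H = {}" using col by fastforce
    with True show ?thesis by (rule quantum_isomorphic_if_empty)
  next
    case False
    obtain d \<rho> where psd: "\<forall>i\<in>pverts G \<times> pverts H. psd d (\<rho> i)"
      and M\<rho>: "\<forall>i\<in>pverts G \<times> pverts H. \<forall>j\<in>pverts G \<times> pverts H.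
        complex_of_real (M i j) = mat_trace (mat_adjoint (\<rho> i) * \<rho> j)"
      using M unfolding CSP_def mem_Collect_eq by (elim exE conjE)
    have \<rho>: "psd d (\<rho> (g, h))" if "g \<in> pverts G" "h \<in> pverts H" for g h
      using psd that by blast
    have tr: "mat_trace (\<rho> (g, h) * \<rho> (g', h')) = complex_of_real (M (g, h) (g', h'))"
      if "g \<in> pverts G" "g' \<in> pverts G" "h \<in> pverts H" "h' \<in> pverts H" for g g' h h'
    proof -
      have "(g, h) \<in> pverts G \<times> pverts H" "(g', h') \<in> pverts G \<times> pverts H" using that by auto
      then have "complex_of_real (M (g, h) (g', h')) = mat_trace (mat_adjoint (\<rho> (g, h)) * \<rho> (g', h'))"
        using M\<rho> by blast
      then show ?thesis by (simp add: psd_adjoint[OF \<rho>] that)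
    qed
    show ?thesis
    proof (rule quantum_isomorphic_if_gram[where d = d and \<rho> = \<rho>, OF fin False \<rho>])
      fix g g' assume g: "g \<in> pverts G" "g' \<in> pverts G"
      have "(\<Sum>h\<in>pverts H. \<Sum>h'\<in>pverts H. mat_trace (\<rho> (g, h) * \<rho> (g', h'))) =
          complex_of_real (\<Sum>h\<in>pverts H. \<Sum>h'\<in>pverts H. M (g, h) (g', h'))"
        by (simp add: tr g)
      then show "(\<Sum>h\<in>pverts H. \<Sum>h'\<in>pverts H. mat_trace (\<rho> (g, h) * \<rho> (g', h'))) = 1"
        unfolding row[OF g] by simp
    next
      fix h h' assume h: "h \<in> pverts H" "h' \<in> pverts H"
      have "(\<Sum>g\<in>pverts G. \<Sum>g'\<in>pverts G. mat_trace (\<rho> (g, h) * \<rho> (g', h'))) =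
          complex_of_real (\<Sum>g\<in>pverts G. \<Sum>g'\<in>pverts G. M (g, h) (g', h'))"
        by (simp add: tr h)
      then show "(\<Sum>g\<in>pverts G. \<Sum>g'\<in>pverts G. mat_trace (\<rho> (g, h) * \<rho> (g', h'))) = 1"
        unfolding col[OF h] by simp
    next
      fix g g' h h'
      assume in_V: "g \<in> pverts G" "g' \<in> pverts G" "h \<in> pverts H" "h' \<in> pverts H"
        and "rel G g g' \<noteq> rel H h h'"
      then show "mat_trace (\<rho> (g, h) * \<rho> (g', h')) = 0" using zero tr[OF in_V] by simp
    qed
  qed
qed

lemma CSP_isomorphic_if_quantum_isomorphic:
  assumes fin: "finite (pverts G)" "finite (pverts H)" and iso: "quantum_isomorphic G H"
  shows "cone_isomorphic CSP G H"
proof -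
  obtain d \<psi> P Q where strat: "quantum_strategy (pverts G <+> pverts H) d \<psi> P Q"
    and perfect: "\<forall>xA\<in>pverts G <+> pverts H. \<forall>xB\<in>pverts G <+> pverts H.
      \<forall>yA\<in>pverts G <+> pverts H. \<forall>yB\<in>pverts G <+> pverts H.
      \<not> wins_iso_game G H xA xB yA yB \<longrightarrow> correlation \<psi> P Q yA yB xA xB = 0"
    using iso unfolding quantum_isomorphic_def Let_def by (elim exE conjE)
  show ?thesis
    by (rule CSP_isomorphic_if_strategy[OF fin strat]) (rule perfect[rule_format])
qed

theorem mainTheorem1:
  fixes G :: "'a pair_pre_digraph" and H :: "'b pair_pre_digraph"
  assumes "pair_graph G" and "pair_graph H"
  shows "(digraph_iso (with_proj G) (with_proj H) \<longleftrightarrow> cone_isomorphic CP G H) \<and>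
         (quantum_isomorphic G H \<longleftrightarrow> cone_isomorphic CSP G H)"
proof -
  note fin = assms[THEN pair_graphD(1)]
  have "digraph_iso (with_proj G) (with_proj H) \<longleftrightarrow> cone_isomorphic CP G H"
    unfolding digraph_iso_with_proj_iff[OF assms]
    using CP_isomorphic_if_bij[OF fin] bij_if_CP_isomorphic[OF fin] by metis
  moreover have "quantum_isomorphic G H \<longleftrightarrow> cone_isomorphic CSP G H"
    using CSP_isomorphic_if_quantum_isomorphic[OF fin] quantum_isomorphic_if_CSP_isomorphic[OF fin]
    by (rule iffI)
  ultimately show ?thesis by (rule conjI)
qed

end
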